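(* Let $d\ge 1$ be an integer. For any integer $k \geq 1$ and any real $\nu > 0$, the random variable $\widetilde{H}_{k,\sqrt[d]{\nu/n}}(n)$ converges almost surely to $a_{k,\nu}$ as $n \to \infty$.
   Context: For $V \subseteq \mathbb{R}^d$ and $r>0$, $G_r(V)$ is the graph with vertex set $V$ in which two distinct points $u,v\in V$ are adjacent if and only if $\|u-v\|\le r$ (Euclidean norm). For $k \in \mathbb{N}=\{1,2,\dots\}$ and finite $V$, $N_{k,r}(V)$ is the maximum number of vertices of $G_r(V)$ that can be properly colored with $k$ colors, i.e., the largest cardinality of a subset $U\subseteq V$ such that the induced subgraph $G_r(U)$ is $k$-colorable. For each $n\in\mathbb{N}$, $\mathcal{I}_n$ is a collection of $n$ points independently and uniformly distributed in the unit cube $[0,1]^d$; the collections $\mathcal{I}_n$, $n\ge 1$, are defined on a common probability space (no assumption is made on their joint distribution for different $n$). Set $H_{k,r}(n) = N_{k,r}(\mathcal{I}_n)$ and $\widetilde{H}_{k,r}(n) = H_{k,r}(n)/n$. For $\lambda>0$, $\mathcal{X}_\lambda$ is a Poisson point process of intensity $\lambda$ in $\mathbb{R}^d$, $F_{k,\lambda}(t) = N_{k,1}([0,t]^d \cap \mathcal{X}_\lambda)$, $\overline{F}_{k,\lambda}(t) = \mathbb{E}\{F_{k,\lambda}(t)\}/(\lambda t^d)$ for $t>0$, and $a_{k,\lambda} = \inf_{t>0}\overline{F}_{k,\lambda}(t)$, which also equals $\lim_{t\to\infty}\overline{F}_{k,\lambda}(t)$. *)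

theory Defs
  imports "HOL-Probability.Probability"
begin

type_synonym 'v graph = "'v set \<times> 'v set set"

definition geometric_graph :: "real \<Rightarrow> (real ^ 'd) set \<Rightarrow> (real ^ 'd) graph" where
  "geometric_graph r V = (V, {{u, v} | u v. u \<in> V \<and> v \<in> V \<and> u \<noteq> v \<and> norm (u - v) \<le> r})"

definition colorable :: "nat \<Rightarrow> 'v graph \<Rightarrow> bool" where
  "colorable k G \<longleftrightarrow>
    (\<exists>c :: 'v \<Rightarrow> nat. (\<forall>v \<in> fst G. c v < k) \<and> (\<forall>u v. {u, v} \<in> snd G \<longrightarrow> c u \<noteq> c v))"

text \<open>Only meaningful for finite \<open>V\<close>. The subgraph of \<open>geometric_graph r V\<close> induced by
  \<open>U \<subseteq> V\<close> is \<open>geometric_graph r U\<close>.\<close>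

definition max_colorable :: "nat \<Rightarrow> real \<Rightarrow> (real ^ 'd) set \<Rightarrow> nat" where
  "max_colorable k r V = Max {card U | U. U \<subseteq> V \<and> colorable k (geometric_graph r U)}"

definition cube :: "real \<Rightarrow> (real ^ 'd) set" where
  "cube t = cbox 0 (\<chi> i. t)"

definition iid_uniform_points :: "'w measure \<Rightarrow> nat \<Rightarrow> (nat \<Rightarrow> 'w \<Rightarrow> real ^ 'd) \<Rightarrow> bool" where
  "iid_uniform_points M n Y \<longleftrightarrow>
    prob_space.indep_vars M (\<lambda>_. borel) Y {..<n} \<and>
    (\<forall>i<n. distr M borel (Y i) = uniform_measure lborel (cube 1))"

definition H_ratio :: "nat \<Rightarrow> real \<Rightarrow> nat \<Rightarrow> (nat \<Rightarrow> 'w \<Rightarrow> real ^ 'd) \<Rightarrow> 'w \<Rightarrow> real" where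
  "H_ratio k r n Y \<omega> = real (max_colorable k r ((\<lambda>i. Y i \<omega>) ` {..<n})) / real n"

text \<open>A Poisson point process is represented as a random locally finite set. The counting laws
  are imposed on bounded Borel sets, where the number of points is finite and \<open>card\<close> returns it.
  The Poisson weights are written out because \<open>poisson_pmf\<close> requires a positive rate and hence
  does not cover null sets.\<close>

locale poisson_process = prob_space P for P :: "'p measure" +
  fixes lam :: real and X :: "'p \<Rightarrow> (real ^ 'd) set"
  assumes intensity_pos: "lam > 0"
    and locally_finite: "\<And>\<omega> B. \<omega> \<in> space P \<Longrightarrow> bounded B \<Longrightarrow> finite (X \<omega> \<inter> B)"
    and count_measurable: "\<And>B. B \<in> sets borel \<Longrightarrow> bounded B \<Longrightarrow>
          (\<lambda>\<omega>. card (X \<omega> \<inter> B)) \<in> measurable P (count_space UNIV)"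
    and count_poisson: "\<And>B j. B \<in> sets borel \<Longrightarrow> bounded B \<Longrightarrow>
          prob {\<omega> \<in> space P. card (X \<omega> \<inter> B) = j} =
            (lam * measure lborel B) ^ j / fact j * exp (- (lam * measure lborel B))"
    and count_indep: "\<And>(B :: nat \<Rightarrow> (real ^ 'd) set) J. finite J \<Longrightarrow> disjoint_family_on B J \<Longrightarrow>
          (\<And>i. i \<in> J \<Longrightarrow> B i \<in> sets borel \<and> bounded (B i)) \<Longrightarrow>
          indep_vars (\<lambda>_. count_space UNIV) (\<lambda>i \<omega>. card (X \<omega> \<inter> B i)) J"

definition F_count :: "nat \<Rightarrow> ('p \<Rightarrow> (real ^ 'd) set) \<Rightarrow> real \<Rightarrow> 'p \<Rightarrow> nat" where
  "F_count k X t \<omega> = max_colorable k 1 (cube t \<inter> X \<omega>)"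

definition F_mean :: "nat \<Rightarrow> 'p measure \<Rightarrow> real \<Rightarrow> ('p \<Rightarrow> (real ^ 'd) set) \<Rightarrow> real \<Rightarrow> real" where
  "F_mean k P lam X t = (\<integral>\<omega>. real (F_count k X t \<omega>) \<partial>P) / (lam * t ^ CARD('d))"

definition a_const :: "nat \<Rightarrow> 'p measure \<Rightarrow> real \<Rightarrow> ('p \<Rightarrow> (real ^ 'd) set) \<Rightarrow> real" where
  "a_const k P lam X = (INF t\<in>{0<..}. F_mean k P lam X t)"

end

theory Submission
  imports Defs
begin

text \<open>The law of the colouring number of a random finite set is determined by the void
  probabilities of the set: along the refining partitions generated by a countable basis, the
  graph on the occupied cells is eventually isomorphic to the graph on the points. Hence the
  restriction of the Poisson process to a cube of side \<open>L\<close> may be replaced by a Poisson number of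
  independent uniform points. For \<open>\<nu> L\<^sup>d = n\<close> this number deviates from \<open>n\<close> by at most
  \<open>sqrt n\<close> on average and the colouring number is 1-Lipschitz in the number of points, so the mean
  of \<open>H_ratio\<close> differs from \<open>F_mean\<close> at \<open>L\<close> by at most \<open>1 / sqrt n\<close>; and \<open>F_mean\<close> converges to its
  infimum because covering a large cube by translates of a fixed one makes the mean colouring
  number subadditive. The bounded differences inequality and the Borel-Cantelli lemma turn
  convergence of means into almost sure convergence, whatever the joint law over different \<open>n\<close>.\<close>

section \<open>Colouring numbers of random finite sets\<close>

text \<open>A graph is given here by a relation on an arbitrary type, so that one notion serves both
  for points under a distance bound and for cells of a partition. The relation is tested at distinct
  vertices only, which makes the loops of a reflexive relation harmless.\<close>

definition kcol :: "nat \<Rightarrow> ('v \<Rightarrow> 'v \<Rightarrow> bool) \<Rightarrow> 'v set \<Rightarrow> bool" where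
  "kcol k R U \<longleftrightarrow>
    (\<exists>c :: 'v \<Rightarrow> nat. \<forall>u\<in>U. c u < k \<and> (\<forall>v\<in>U. u \<noteq> v \<longrightarrow> R u v \<longrightarrow> c u \<noteq> c v))"

definition maxcol :: "nat \<Rightarrow> ('v \<Rightarrow> 'v \<Rightarrow> bool) \<Rightarrow> 'v set \<Rightarrow> nat" where
  "maxcol k R S = Max {card U | U. U \<subseteq> S \<and> kcol k R U}"

lemma kcol_geometric: "colorable k (geometric_graph r U) \<longleftrightarrow> kcol k (\<lambda>u v. dist u v \<le> r) U"
proof -
  have "{u, v} \<in> snd (geometric_graph r U) \<longleftrightarrow> u \<in> U \<and> v \<in> U \<and> u \<noteq> v \<and> dist u v \<le> r" for u v
    by (auto simp: geometric_graph_def doubleton_eq_iff dist_norm norm_minus_commute)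
  then show ?thesis
    unfolding colorable_def kcol_def by (auto simp: geometric_graph_def)
qed

lemma max_colorable_eq_maxcol: "max_colorable k r V = maxcol k (\<lambda>u v. dist u v \<le> r) V"
  by (simp add: max_colorable_def maxcol_def kcol_geometric)

lemma kcol_subset: "kcol k R U \<Longrightarrow> W \<subseteq> U \<Longrightarrow> kcol k R W"
  unfolding kcol_def by (meson subsetD)

lemma kcol_image:
  assumes "inj_on f U" "\<And>u v. u \<in> U \<Longrightarrow> v \<in> U \<Longrightarrow> u \<noteq> v \<Longrightarrow> R' (f u) (f v) \<longleftrightarrow> R u v"
  shows "kcol k R' (f ` U) \<longleftrightarrow> kcol k R U"
proof
  assume "kcol k R' (f ` U)"
  then obtain c where "\<forall>u\<in>f ` U. c u < k \<and> (\<forall>v\<in>f ` U. u \<noteq> v \<longrightarrow> R' u v \<longrightarrow> c u \<noteq> c v)"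
    unfolding kcol_def by blast
  then have "\<forall>u\<in>U. c (f u) < k \<and> (\<forall>v\<in>U. u \<noteq> v \<longrightarrow> R u v \<longrightarrow> c (f u) \<noteq> c (f v))"
    using assms by (auto simp: inj_on_eq_iff)
  then show "kcol k R U" unfolding kcol_def by (rule exI[of _ "\<lambda>u. c (f u)"])
next
  assume "kcol k R U"
  then obtain c where c: "\<forall>u\<in>U. c u < k \<and> (\<forall>v\<in>U. u \<noteq> v \<longrightarrow> R u v \<longrightarrow> c u \<noteq> c v)"
    unfolding kcol_def by blast
  have "\<forall>u\<in>f ` U. c (inv_into U f u) < k \<and>
      (\<forall>v\<in>f ` U. u \<noteq> v \<longrightarrow> R' u v \<longrightarrow> c (inv_into U f u) \<noteq> c (inv_into U f v))"
    using c assms by (auto simp: inj_on_eq_iff)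
  then show "kcol k R' (f ` U)" unfolding kcol_def by (rule exI[of _ "\<lambda>u. c (inv_into U f u)"])
qed

lemma
  assumes "finite S"
  shows maxcol_attained: "\<exists>U\<subseteq>S. kcol k R U \<and> card U = maxcol k R S"
    and card_le_maxcol: "U \<subseteq> S \<Longrightarrow> kcol k R U \<Longrightarrow> card U \<le> maxcol k R S"
proof -
  let ?A = "{card U | U. U \<subseteq> S \<and> kcol k R U}"
  have fin: "finite ?A"
    using assms by (auto intro: finite_subset[of _ "card ` Pow S"])
  \<comment> \<open>The empty set is colourable even for \<open>k = 0\<close>, so the maximum is
    taken over a nonempty set.\<close>
  have "kcol k R {}" by (simp add: kcol_def)
  then have "?A \<noteq> {}" by blast
  then have "Max ?A \<in> ?A" using fin by (rule Max_in[rotated])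
  then show "\<exists>U\<subseteq>S. kcol k R U \<and> card U = maxcol k R S"
    unfolding maxcol_def by auto
  show "card U \<le> maxcol k R S" if "U \<subseteq> S" "kcol k R U"
    unfolding maxcol_def using fin that by (intro Max_ge) auto
qed

lemma maxcol_le_card: "finite S \<Longrightarrow> maxcol k R S \<le> card S"
  using maxcol_attained[of S k R] by (metis card_mono)

lemma maxcol_mono: "finite T \<Longrightarrow> S \<subseteq> T \<Longrightarrow> maxcol k R S \<le> maxcol k R T"
  using maxcol_attained[of S k R] card_le_maxcol[of T] by (metis finite_subset subset_trans)

text \<open>The traces on \<open>S\<close> and on \<open>T\<close> of an optimal subset of the union
  stay colourable. Both the subadditivity over tiles and the Lipschitz bounds in the number of
  points come from this.\<close>

lemma maxcol_Un:
  assumes "finite S" "finite T"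
  shows "maxcol k R (S \<union> T) \<le> maxcol k R S + maxcol k R T"
proof -
  obtain U where U: "U \<subseteq> S \<union> T" "kcol k R U" "card U = maxcol k R (S \<union> T)"
    using maxcol_attained[of "S \<union> T" k R] assms by auto
  have "card U \<le> card (U \<inter> S) + card (U \<inter> T)"
    using card_Un_le[of "U \<inter> S" "U \<inter> T"] U(1) by (simp add: Int_Un_distrib[symmetric] Int_absorb2)
  also have "\<dots> \<le> maxcol k R S + maxcol k R T"
    using U(2) assms by (intro add_mono card_le_maxcol) (auto intro: kcol_subset)
  finally show ?thesis using U(3) by simp
qed

lemma maxcol_empty [simp]: "maxcol k R {} = 0"
  using maxcol_le_card[of "{}" k R] by simp

lemma maxcol_UN:
  "finite I \<Longrightarrow> (\<And>i. i \<in> I \<Longrightarrow> finite (S i)) \<Longrightarrow> maxcol k R (\<Union>i\<in>I. S i) \<le> (\<Sum>i\<in>I. maxcol k R (S i))"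
proof (induction rule: finite_induct)
  case (insert i I)
  then show ?case
    using maxcol_Un[of "S i" "\<Union>i\<in>I. S i" k R] by auto
qed auto

lemma maxcol_image:
  assumes "inj_on f S" "\<And>u v. u \<in> S \<Longrightarrow> v \<in> S \<Longrightarrow> u \<noteq> v \<Longrightarrow> R' (f u) (f v) \<longleftrightarrow> R u v"
  shows "maxcol k R' (f ` S) = maxcol k R S"
proof -
  have "{card U | U. U \<subseteq> f ` S \<and> kcol k R' U} = {card U | U. U \<subseteq> S \<and> kcol k R U}" (is "?A = ?B")
  proof -
    have *: "card (f ` U) = card U" "kcol k R' (f ` U) \<longleftrightarrow> kcol k R U" if "U \<subseteq> S" for U
      using that assms by (auto intro!: card_image kcol_image simp: subset_iff intro: inj_on_subset)
    have "?A = {card (f ` U) | U. U \<subseteq> S \<and> kcol k R' (f ` U)}"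
      by (auto simp: subset_image_iff)
    also have "\<dots> = ?B" using * by (auto, metis)
    finally show ?thesis .
  qed
  then show ?thesis by (simp add: maxcol_def)
qed

section \<open>Approximation of a graph by finite partitions into cells\<close>

text \<open>The label names the atom containing \<open>x\<close> of the partition generated by the
  first \<open>j\<close> sets.\<close>

definition cell_label :: "(nat \<Rightarrow> 'a set) \<Rightarrow> nat \<Rightarrow> 'a \<Rightarrow> nat set" where
  "cell_label B j x = {i. i < j \<and> x \<in> B i}"

text \<open>The image of \<open>R\<close> under \<open>q\<close>: one related pair of points
  suffices to relate two cells. Passing to cells can therefore create edges but never lose
  one.\<close>

definition cell_rel :: "('a \<Rightarrow> 'l) \<Rightarrow> ('a \<Rightarrow> 'a \<Rightarrow> bool) \<Rightarrow> 'l \<Rightarrow> 'l \<Rightarrow> bool" where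
  "cell_rel q R z z' \<longleftrightarrow> (\<exists>a b. q a = z \<and> q b = z' \<and> R a b)"

text \<open>A basis set separates two distinct points, and two basis sets separate an unrelated pair
  from the closed relation. Only finitely many such sets are involved for a finite \<open>V\<close>;
  once \<open>j\<close> exceeds their indices, the labelling is a graph isomorphism from
  \<open>V\<close> onto its set of labels.\<close>

lemma eventually_maxcol_cells:
  fixes B :: "nat \<Rightarrow> 'a :: t2_space set"
  assumes B: "topological_basis (range B)" and R: "closed {(u, v). R u v}" and V: "finite V"
  shows "\<forall>\<^sub>F j in sequentially.
    maxcol k (cell_rel (cell_label B j) R) (cell_label B j ` V) = maxcol k R V"
proof -
  have inB: "x \<in> B i" if "cell_label B j x = cell_label B j y" "i < j" "y \<in> B i" for i j x y
    using that by (auto simp: cell_label_def)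
  have basis: "\<exists>i. x \<in> B i \<and> B i \<subseteq> U" if "open U" "x \<in> U" for x U
    using topological_basisE[OF B that] by (metis rangeE)
  have 1: "\<forall>\<^sub>F j in sequentially. cell_label B j u \<noteq> cell_label B j v" if uv: "u \<noteq> v" for u v
  proof -
    obtain i where i: "u \<in> B i" "v \<notin> B i"
      using basis[of "- {v}" u] uv by (auto simp: open_Compl)
    show ?thesis
      using eventually_gt_at_top[of i] by eventually_elim (use i inB in blast)
  qed
  have 2: "\<forall>\<^sub>F j in sequentially. \<not> cell_rel (cell_label B j) R (cell_label B j u) (cell_label B j v)"
    if "\<not> R u v" for u v
  proof -
    have "open (- {(u, v). R u v})" "(u, v) \<in> - {(u, v). R u v}" using R that by auto
    from open_prod_elim[OF this] obtain X Y where
      XY: "open X" "open Y" "u \<in> X" "v \<in> Y" "X \<times> Y \<subseteq> - {(u, v). R u v}" by (metis mem_Sigma_iff)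
    obtain i i' where "u \<in> B i" "B i \<subseteq> X" "v \<in> B i'" "B i' \<subseteq> Y"
      using basis XY by metis
    with XY have i: "u \<in> B i" "v \<in> B i'" "\<And>a b. a \<in> B i \<Longrightarrow> b \<in> B i' \<Longrightarrow> \<not> R a b" by auto
    show ?thesis
      using eventually_gt_at_top[of i] eventually_gt_at_top[of i']
      by eventually_elim (unfold cell_rel_def, use i inB in metis)
  qed
  have "\<forall>\<^sub>F j in sequentially. \<forall>u\<in>V. \<forall>v\<in>V. (u \<noteq> v \<longrightarrow> cell_label B j u \<noteq> cell_label B j v) \<and>
      (\<not> R u v \<longrightarrow> \<not> cell_rel (cell_label B j) R (cell_label B j u) (cell_label B j v))"
    by (intro eventually_ball_finite ballI V eventually_conj) (use 1 2 in \<open>auto simp: eventually_mono\<close>)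
  then show ?thesis
  proof eventually_elim
    case (elim j)
    then have "inj_on (cell_label B j) V" by (meson inj_onI)
    \<comment> \<open>Related points have related labels for every \<open>j\<close>; only the
      converse uses that \<open>j\<close> is large.\<close>
    moreover have "cell_rel (cell_label B j) R (cell_label B j u) (cell_label B j v) \<longleftrightarrow> R u v"
      if "u \<in> V" "v \<in> V" for u v
      using elim that unfolding cell_rel_def by blast
    ultimately show ?case by (intro maxcol_image)
  qed
qed

section \<open>Laws determined by void probabilities\<close>

text \<open>Measurability is required of the void events only. For a closed relation it already
  carries over to \<open>maxcol\<close>, so no sigma-algebra on the space of finite sets has to be
  introduced.\<close>

definition random_finite_set :: "'w measure \<Rightarrow> ('w \<Rightarrow> 'a :: topological_space set) \<Rightarrow> bool" where
  "random_finite_set M V \<longleftrightarrow> (\<forall>\<omega>\<in>space M. finite (V \<omega>)) \<and>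
    (\<forall>A\<in>sets borel. {\<omega>\<in>space M. V \<omega> \<inter> A = {}} \<in> sets M)"

text \<open>All occupied labels lie in \<open>T\<close> exactly when the preimage of the complement
  of \<open>T\<close> is void. The event that \<open>T\<close> is the exact set of occupied labels
  arises by removing, for each label of \<open>T\<close>, the event that this label is
  missed.\<close>

lemma random_finite_set_labels:
  assumes V: "random_finite_set M V" and q: "q \<in> measurable borel (count_space UNIV)"
  shows "{\<omega>\<in>space M. q ` V \<omega> \<subseteq> T} = {\<omega>\<in>space M. V \<omega> \<inter> q -` (- T) = {}}"
    and "{\<omega>\<in>space M. q ` V \<omega> \<subseteq> T} \<in> sets M"
    and "{\<omega>\<in>space M. q ` V \<omega> = T} \<in> sets M"
proof -
  show eq: "{\<omega>\<in>space M. q ` V \<omega> \<subseteq> T} = {\<omega>\<in>space M. V \<omega> \<inter> q -` (- T) = {}}" for T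
    by auto
  have "q -` (- T) \<in> sets borel" for T
    using measurable_sets[OF q, of "- T"] by simp
  then show sub: "{\<omega>\<in>space M. q ` V \<omega> \<subseteq> T} \<in> sets M" for T
    unfolding eq using V by (auto simp: random_finite_set_def)
  show "{\<omega>\<in>space M. q ` V \<omega> = T} \<in> sets M"
  proof (cases "finite T")
    case True
    have "{\<omega>\<in>space M. q ` V \<omega> = T} =
        {\<omega>\<in>space M. q ` V \<omega> \<subseteq> T} - (\<Union>t\<in>T. {\<omega>\<in>space M. q ` V \<omega> \<subseteq> T - {t}})"
      by blast
    also have "\<dots> \<in> sets M" using True sub by auto
    finally show ?thesis .
  next
    case False
    then have "{\<omega>\<in>space M. q ` V \<omega> = T} = {}"
      using V by (auto simp: random_finite_set_def)
    then show ?thesis by (metis sets.empty_sets)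
  qed
qed

text \<open>Inclusion-exclusion over the sets of occupied cells, in the form of an induction.\<close>

lemma prob_labels_eq:
  assumes "prob_space M1" "prob_space M2"
    and V1: "random_finite_set M1 V1" and V2: "random_finite_set M2 V2"
    and void: "\<And>A. A \<in> sets borel \<Longrightarrow>
      measure M1 {\<omega>\<in>space M1. V1 \<omega> \<inter> A = {}} = measure M2 {\<omega>\<in>space M2. V2 \<omega> \<inter> A = {}}"
    and q: "q \<in> measurable borel (count_space UNIV)" and "finite T"
  shows "measure M1 {\<omega>\<in>space M1. q ` V1 \<omega> = T} = measure M2 {\<omega>\<in>space M2. q ` V2 \<omega> = T}"
  using \<open>finite T\<close>
proof (induction T rule: finite_psubset_induct)
  case (psubset T)
  \<comment> \<open>Splitting by the exact set of occupied labels isolates the term for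
    \<open>T\<close>. The left side is a void probability and the remaining sum runs over proper
    subsets, so equality for \<open>T\<close> follows from the induction hypothesis.\<close>
  have *: "measure M {\<omega>\<in>space M. q ` V \<omega> \<subseteq> T} =
      measure M {\<omega>\<in>space M. q ` V \<omega> = T} + (\<Sum>S\<in>Pow T - {T}. measure M {\<omega>\<in>space M. q ` V \<omega> = S})"
    if "prob_space M" "random_finite_set M V" for M :: "'z measure" and V
  proof -
    interpret prob_space M by fact
    have "{\<omega>\<in>space M. q ` V \<omega> \<subseteq> T} = (\<Union>S\<in>Pow T. {\<omega>\<in>space M. q ` V \<omega> = S})" by auto
    also have "measure M \<dots> = (\<Sum>S\<in>Pow T. measure M {\<omega>\<in>space M. q ` V \<omega> = S})"
      using psubset.hyps random_finite_set_labels[OF that(2) q]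
      by (intro finite_measure_finite_Union) (auto simp: disjoint_family_on_def)
    also have "\<dots> = measure M {\<omega>\<in>space M. q ` V \<omega> = T} +
        (\<Sum>S\<in>Pow T - {T}. measure M {\<omega>\<in>space M. q ` V \<omega> = S})"
      using psubset.hyps by (intro sum.remove) auto
    finally show ?thesis .
  qed
  have "q -` (- T) \<in> sets borel"
    using measurable_sets[OF q, of "- T"] by simp
  then have "measure M1 {\<omega>\<in>space M1. q ` V1 \<omega> \<subseteq> T} = measure M2 {\<omega>\<in>space M2. q ` V2 \<omega> \<subseteq> T}"
    unfolding random_finite_set_labels(1)[OF V1 q] random_finite_set_labels(1)[OF V2 q] by (rule void)
  moreover have "(\<Sum>S\<in>Pow T - {T}. measure M1 {\<omega>\<in>space M1. q ` V1 \<omega> = S}) =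
      (\<Sum>S\<in>Pow T - {T}. measure M2 {\<omega>\<in>space M2. q ` V2 \<omega> = S})"
    by (intro sum.cong psubset.IH) auto
  ultimately show ?case
    using *[OF assms(1) V1] *[OF assms(2) V2] by linarith
qed

lemma countable_basis_sequence:
  obtains B :: "nat \<Rightarrow> 'a :: second_countable_topology set" where "topological_basis (range B)"
proof -
  obtain \<B> :: "'a set set" where \<B>: "countable \<B>" "topological_basis \<B>"
    using ex_countable_basis by blast
  have "\<B> \<noteq> {}"
    using topological_basisE[OF \<B>(2) open_UNIV UNIV_I] by blast
  then have "range (from_nat_into \<B>) = \<B>" using \<B>(1) by (rule range_from_nat_into)
  with \<B>(2) that show ?thesis by metis
qed

lemma measurable_cell_label:
  assumes B: "topological_basis (range B)"
  shows "cell_label B j \<in> measurable borel (count_space UNIV)"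
proof -
  have [measurable]: "B i \<in> sets borel" for i
    using topological_basis_open[OF B] by auto
  \<comment> \<open>With the finite codomain \<open>Pow {..<j}\<close> it suffices to look at
    fibres, each of which is a finite Boolean combination of basis sets.\<close>
  have "cell_label B j \<in> measurable borel (count_space (Pow {..<j}))"
  proof (subst measurable_count_space_eq2, simp, intro conjI ballI)
    show "cell_label B j \<in> space borel \<rightarrow> Pow {..<j}" by (auto simp: cell_label_def)
    fix S assume "S \<in> Pow {..<j}"
    then have "cell_label B j -` {S} \<inter> space borel = {x \<in> space borel. \<forall>i<j. x \<in> B i \<longleftrightarrow> i \<in> S}"
      by (intro set_eqI) (simp add: cell_label_def set_eq_iff subset_iff, meson)
    also have "\<dots> \<in> sets borel"
      by measurable
    finally show "cell_label B j -` {S} \<inter> space borel \<in> sets borel" .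
  qed
  then show ?thesis by (rule measurable_compose) simp
qed

text \<open>The colouring number is the pointwise limit of the colouring numbers \<open>g j\<close>
  of the cell graphs. An event about \<open>g j\<close> is a finite disjoint union of exact-label
  events, whose probabilities are fixed by the void probabilities; dominated convergence carries the
  equality to the limit.\<close>

lemma
  fixes R :: "'a :: {second_countable_topology, t2_space} \<Rightarrow> 'a \<Rightarrow> bool"
  assumes R: "closed {(u, v). R u v}" and V1: "random_finite_set M1 V1"
  shows measurable_maxcol: "(\<lambda>\<omega>. maxcol k R (V1 \<omega>)) \<in> measurable M1 (count_space UNIV)"
    and distr_maxcol_eq: "\<lbrakk>prob_space M1; prob_space M2; random_finite_set M2 V2;
      \<And>A. A \<in> sets borel \<Longrightarrow>
        measure M1 {\<omega>\<in>space M1. V1 \<omega> \<inter> A = {}} = measure M2 {\<omega>\<in>space M2. V2 \<omega> \<inter> A = {}}\<rbrakk> \<Longrightarrow>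
      distr M1 (count_space UNIV) (\<lambda>\<omega>. maxcol k R (V1 \<omega>)) =
      distr M2 (count_space UNIV) (\<lambda>\<omega>. maxcol k R (V2 \<omega>))"
proof -
  obtain B :: "nat \<Rightarrow> 'a set" where B: "topological_basis (range B)"
    by (rule countable_basis_sequence)
  define g where "g j T = maxcol k (cell_rel (cell_label B j) R) T" for j T
  let ?E = "\<lambda>M V j T. {\<omega>\<in>space M. cell_label B j ` V \<omega> = T}"
  let ?G = "\<lambda>j m. {T\<in>Pow (Pow {..<j}). g j T = m}"
  note q = measurable_cell_label[OF B]
  have g_meas: "(\<lambda>\<omega>. g j (cell_label B j ` V \<omega>)) \<in> measurable M (count_space UNIV)"
    and g_eq: "{\<omega>\<in>space M. g j (cell_label B j ` V \<omega>) = m} = (\<Union>T\<in>?G j m. ?E M V j T)"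
    if V: "random_finite_set M V" for M :: "'z measure" and V j m
  proof -
    show eq: "{\<omega>\<in>space M. g j (cell_label B j ` V \<omega>) = m} = (\<Union>T\<in>?G j m. ?E M V j T)" for m
      by (auto simp: cell_label_def)
    have "{\<omega>\<in>space M. g j (cell_label B j ` V \<omega>) = m} \<in> sets M" for m
      unfolding eq using random_finite_set_labels(3)[OF V q] by (intro sets.finite_UN) auto
    then show "(\<lambda>\<omega>. g j (cell_label B j ` V \<omega>)) \<in> measurable M (count_space UNIV)"
      by (auto simp: measurable_count_space_eq_countable vimage_def Int_def conj_commute)
  qed
  have ev: "\<forall>\<^sub>F j in sequentially. g j (cell_label B j ` V \<omega>) = maxcol k R (V \<omega>)"
    if "random_finite_set M V" "\<omega> \<in> space M" for M :: "'z measure" and V \<omega>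
    unfolding g_def using eventually_maxcol_cells[OF B R] that by (auto simp: random_finite_set_def)
  \<comment> \<open>Working with the indicator of each value \<open>m\<close> gives real functions
    bounded by 1, to which the limit theorems for measurability and integrals apply.\<close>
  have lim: "(\<lambda>j. indicator {m} (g j (cell_label B j ` V \<omega>)) :: real)
      \<longlonglongrightarrow> indicator {m} (maxcol k R (V \<omega>))"
    if "random_finite_set M V" "\<omega> \<in> space M" for M :: "'z measure" and V \<omega> m
    by (intro tendsto_eventually eventually_mono[OF ev[OF that]]) simp
  have meas: "(\<lambda>\<omega>. maxcol k R (V \<omega>)) \<in> measurable M (count_space UNIV)"
    if V: "random_finite_set M V" for M :: "'z measure" and V
  proof -
    have "(\<lambda>\<omega>. indicator {m} (maxcol k R (V \<omega>)) :: real) \<in> borel_measurable M" for m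
      by (intro borel_measurable_LIMSEQ_real[OF lim[OF V]] measurable_compose[OF g_meas[OF V]]) auto
    then have "(\<lambda>\<omega>. indicator {m} (maxcol k R (V \<omega>)) :: real) -` {1} \<inter> space M \<in> sets M" for m
      by (rule measurable_sets) auto
    also have "(\<lambda>\<omega>. indicator {m} (maxcol k R (V \<omega>)) :: real) -` {1} \<inter> space M =
        (\<lambda>\<omega>. maxcol k R (V \<omega>)) -` {m} \<inter> space M" for m
      by (auto simp: indicator_def)
    finally show ?thesis
      by (subst measurable_count_space_eq_countable) auto
  qed
  show "(\<lambda>\<omega>. maxcol k R (V1 \<omega>)) \<in> measurable M1 (count_space UNIV)"
    by (rule meas[OF V1])
  show "distr M1 (count_space UNIV) (\<lambda>\<omega>. maxcol k R (V1 \<omega>)) =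
      distr M2 (count_space UNIV) (\<lambda>\<omega>. maxcol k R (V2 \<omega>))"
    if P: "prob_space M1" "prob_space M2" and V2: "random_finite_set M2 V2"
      and void: "\<And>A. A \<in> sets borel \<Longrightarrow>
        measure M1 {\<omega>\<in>space M1. V1 \<omega> \<inter> A = {}} = measure M2 {\<omega>\<in>space M2. V2 \<omega> \<inter> A = {}}"
  proof -
    have conv: "(\<lambda>j. \<Sum>T\<in>?G j m. measure M (?E M V j T)) \<longlonglongrightarrow>
        measure M {\<omega>\<in>space M. maxcol k R (V \<omega>) = m}"
      if "prob_space M" and V: "random_finite_set M V" for M :: "'z measure" and V m
    proof -
      interpret prob_space M by fact
      have "(\<lambda>j. \<integral>\<omega>. indicator {m} (g j (cell_label B j ` V \<omega>)) \<partial>M) \<longlonglongrightarrow>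
          (\<integral>\<omega>. indicator {m} (maxcol k R (V \<omega>)) \<partial>M :: real)"
        using g_meas[OF V] meas[OF V] lim[OF V]
        by (intro integral_dominated_convergence[where w = "\<lambda>_. 1"])
          (auto intro!: measurable_compose[of _ M "count_space UNIV"] simp: indicator_def)
      moreover have "(\<integral>\<omega>. indicator {m} (g j (cell_label B j ` V \<omega>)) \<partial>M) =
          (\<Sum>T\<in>?G j m. measure M (?E M V j T))" for j
      proof -
        have "(\<integral>\<omega>. indicator {m} (g j (cell_label B j ` V \<omega>)) \<partial>M) =
            (\<integral>\<omega>. indicator {\<omega>\<in>space M. g j (cell_label B j ` V \<omega>) = m} \<omega> \<partial>M :: real)"
          by (intro Bochner_Integration.integral_cong) (auto simp: indicator_def)
        also have "\<dots> = measure M (\<Union>T\<in>?G j m. ?E M V j T)"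
          unfolding g_eq[OF V] by (simp, intro arg_cong[where f = "measure M"]) auto
        also have "\<dots> = (\<Sum>T\<in>?G j m. measure M (?E M V j T))"
          using random_finite_set_labels(3)[OF V q]
          by (intro finite_measure_finite_Union) (auto simp: disjoint_family_on_def)
        finally show ?thesis .
      qed
      moreover have "(\<integral>\<omega>. indicator {m} (maxcol k R (V \<omega>)) \<partial>M) =
          measure M {\<omega>\<in>space M. maxcol k R (V \<omega>) = m}"
      proof -
        have "(\<integral>\<omega>. indicator {m} (maxcol k R (V \<omega>)) \<partial>M) =
            (\<integral>\<omega>. indicator {\<omega>\<in>space M. maxcol k R (V \<omega>) = m} \<omega> \<partial>M :: real)"
          by (intro Bochner_Integration.integral_cong) (auto simp: indicator_def)
        then show ?thesis by (simp add: Int_absorb2)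
      qed
      ultimately show ?thesis by simp
    qed
    have "measure M1 {\<omega>\<in>space M1. maxcol k R (V1 \<omega>) = m} =
        measure M2 {\<omega>\<in>space M2. maxcol k R (V2 \<omega>) = m}" for m
    proof (rule LIMSEQ_unique[OF conv[OF P(1) V1]])
      have "(\<Sum>T\<in>?G j m. measure M1 (?E M1 V1 j T)) = (\<Sum>T\<in>?G j m. measure M2 (?E M2 V2 j T))" for j
        by (intro sum.cong prob_labels_eq[OF P V1 V2 void q])
          (auto intro: finite_subset[of _ "Pow {..<j}"])
      then show "(\<lambda>j. \<Sum>T\<in>?G j m. measure M1 (?E M1 V1 j T)) \<longlonglongrightarrow>
          measure M2 {\<omega>\<in>space M2. maxcol k R (V2 \<omega>) = m}"
        using conv[OF P(2) V2, of m] by simp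
    qed
    then have "emeasure M1 {\<omega>\<in>space M1. maxcol k R (V1 \<omega>) = m} =
        emeasure M2 {\<omega>\<in>space M2. maxcol k R (V2 \<omega>) = m}" for m
      using P by (simp add: finite_measure.emeasure_eq_measure prob_space.finite_measure)
    then show ?thesis
      using meas[OF V1] meas[OF V2]
      by (intro measure_eqI_countable[of _ UNIV])
        (auto simp: emeasure_distr vimage_def Int_def conj_commute)
  qed
qed

section \<open>The bounded differences inequality\<close>

text \<open>An oscillation of at most \<open>c\<close> confines \<open>f\<close> to an interval of
  length \<open>c\<close> starting at its infimum, and there Hoeffding's lemma for bounded variables
  applies.\<close>

lemma (in prob_space) Hoeffdings_lemma_oscillation:
  fixes f :: "'a \<Rightarrow> real"
  assumes [measurable]: "f \<in> borel_measurable M" and "l > 0"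
    and osc: "\<And>x y. x \<in> space M \<Longrightarrow> y \<in> space M \<Longrightarrow> \<bar>f x - f y\<bar> \<le> c"
  shows "(\<integral>\<^sup>+x. ennreal (exp (l * (f x - expectation f))) \<partial>M) \<le> ennreal (exp (l\<^sup>2 * c\<^sup>2 / 8))"
proof -
  obtain x0 where x0: "x0 \<in> space M" using not_empty by blast
  define a where "a = (INF x\<in>space M. f x)"
  have "bdd_below (f ` space M)"
    using osc[OF x0] by (intro bdd_belowI[of _ "f x0 - c"]) (force simp: abs_le_iff)
  then have "a \<le> f x" if "x \<in> space M" for x
    unfolding a_def using that by (rule cINF_lower)
  moreover have "f x - c \<le> a" if "x \<in> space M" for x
    unfolding a_def using x0 osc that by (intro cINF_greatest) (fastforce simp: abs_le_iff algebra_simps)+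
  ultimately interpret interval_bounded_random_variable M f a "a + c"
    by unfold_locales (auto intro!: AE_I2 simp: algebra_simps)
  show ?thesis
    using Hoeffdings_lemma_nn_integral[OF \<open>l > 0\<close>] by simp
qed

text \<open>Induction on the coordinates takes the place of a martingale. With the other coordinates
  fixed, \<open>f\<close> oscillates by at most \<open>c\<close> in coordinate \<open>i\<close>, so
  integrating that coordinate out costs one factor from Hoeffding's lemma; the average
  \<open>g\<close> satisfies the same hypotheses on the remaining coordinates.\<close>

lemma bounded_differences_mgf:
  fixes f :: "('i \<Rightarrow> 'a) \<Rightarrow> real"
  assumes N: "\<And>i. prob_space (N i)" and "finite I" and "l > 0"
    and "f \<in> borel_measurable (PiM I N)"
    and "\<And>x. x \<in> space (PiM I N) \<Longrightarrow> \<bar>f x\<bar> \<le> C"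
    and "\<And>x i y. x \<in> space (PiM I N) \<Longrightarrow> i \<in> I \<Longrightarrow> y \<in> space (N i) \<Longrightarrow> \<bar>f (x(i := y)) - f x\<bar> \<le> c"
  shows "(\<integral>\<^sup>+x. ennreal (exp (l * (f x - (\<integral>x. f x \<partial>PiM I N)))) \<partial>PiM I N)
    \<le> ennreal (exp (real (card I) * (l\<^sup>2 * c\<^sup>2 / 8)))"
  using assms(2,4-6)
proof (induction I arbitrary: f rule: finite_induct)
  case empty
  interpret product_prob_space N "{}" by (simp add: product_prob_spaceI N)
  \<comment> \<open>Without coordinates the product is a point mass, on which \<open>f\<close>
    equals its mean.\<close>
  have "(\<integral>x. f x \<partial>PiM {} N) = f (\<lambda>_. undefined)"
    by (simp add: PiM_empty lebesgue_integral_count_space_finite)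
  then show ?case by (simp add: PiM_empty nn_integral_count_space_finite)
next
  case (insert i I f)
  interpret Ni: prob_space "N i" by (rule N)
  interpret PI: prob_space "PiM I N" by (intro prob_space_PiM N)
  interpret PiI: prob_space "PiM (insert i I) N" by (intro prob_space_PiM N)
  interpret product_prob_space N UNIV by (simp add: product_prob_spaceI N)
  note [measurable] = insert.prems(1)
  define g where "g x = (\<integral>y. f (x(i := y)) \<partial>N i)" for x
  have upd: "x(i := y) \<in> space (PiM (insert i I) N)" if "x \<in> space (PiM I N)" "y \<in> space (N i)" for x y
    using that by (auto simp: space_PiM PiE_iff extensional_def)
  have [measurable]: "(\<lambda>(x, y). f (x(i := y))) \<in> borel_measurable (PiM I N \<Otimes>\<^sub>M N i)"
    using measurable_compose[OF measurable_add_dim insert.prems(1)] by (simp add: split_beta')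
  have slice [measurable]: "(\<lambda>y. f (x(i := y))) \<in> borel_measurable (N i)"
    if "x \<in> space (PiM I N)" for x
    using measurable_compose[OF measurable_component_update[OF that insert.hyps(2)] insert.prems(1)] .
  have int_slice: "integrable (N i) (\<lambda>y. f (x(i := y)))" if "x \<in> space (PiM I N)" for x
    using slice[OF that] insert.prems(2) upd that
    by (intro Ni.integrable_const_bound[where B = C]) (auto intro!: AE_I2)
  have g_meas [measurable]: "g \<in> borel_measurable (PiM I N)"
    unfolding g_def by measurable
  have g_bound: "\<bar>g x\<bar> \<le> C" if "x \<in> space (PiM I N)" for x
  proof -
    have "\<bar>g x\<bar> \<le> (\<integral>y. \<bar>f (x(i := y))\<bar> \<partial>N i)"
      unfolding g_def by (rule integral_abs_bound)
    also have "\<dots> \<le> (\<integral>y. C \<partial>N i)"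
      using int_slice[OF that] insert.prems(2) upd that by (intro integral_mono) auto
    finally show ?thesis by (simp add: Ni.prob_space)
  qed
  \<comment> \<open>Changes in the distinct coordinates \<open>i\<close> and \<open>j\<close>
    commute, so the bound for \<open>f\<close> survives averaging over coordinate
    \<open>i\<close>.\<close>
  have g_diff: "\<bar>g (x(j := z)) - g x\<bar> \<le> c"
    if x: "x \<in> space (PiM I N)" and j: "j \<in> I" and z: "z \<in> space (N j)" for x j z
  proof -
    have xz: "x(j := z) \<in> space (PiM I N)"
      using x j z by (auto simp: space_PiM PiE_iff extensional_def)
    have "j \<noteq> i" using j insert.hyps by auto
    have "\<bar>g (x(j := z)) - g x\<bar> = \<bar>\<integral>y. f (x(j := z, i := y)) - f (x(i := y)) \<partial>N i\<bar>"
      unfolding g_def using int_slice x xz by simp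
    also have "\<dots> \<le> (\<integral>y. \<bar>f (x(j := z, i := y)) - f (x(i := y))\<bar> \<partial>N i)"
      by (rule integral_abs_bound)
    also have "\<dots> \<le> (\<integral>y. c \<partial>N i)"
    proof (intro integral_mono)
      fix y assume y: "y \<in> space (N i)"
      have "x(j := z, i := y) = x(i := y, j := z)" using \<open>j \<noteq> i\<close> by (rule fun_upd_twist)
      then show "\<bar>f (x(j := z, i := y)) - f (x(i := y))\<bar> \<le> c"
        using insert.prems(3)[OF upd[OF x y], of j z] j z by (simp del: fun_upd_apply)
    qed (use int_slice x xz in auto)
    finally show ?thesis by (simp add: Ni.prob_space)
  qed
  have int_f: "integrable (PiM (insert i I) N) f"
    using insert.prems(2) by (intro PiI.integrable_const_bound[where B = C]) (auto intro!: AE_I2)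
  \<comment> \<open>By Fubini \<open>f\<close> and \<open>g\<close> have the same mean, so the
    centring constant does not change in the induction.\<close>
  have Ef: "(\<integral>x. f x \<partial>PiM (insert i I) N) = (\<integral>x. g x \<partial>PiM I N)"
    unfolding g_def by (rule product_integral_insert[OF insert.hyps int_f])
  let ?E = "\<integral>x. g x \<partial>PiM I N"
  have "(\<integral>\<^sup>+x. ennreal (exp (l * (f x - (\<integral>x. f x \<partial>PiM (insert i I) N)))) \<partial>PiM (insert i I) N) =
      (\<integral>\<^sup>+x. \<integral>\<^sup>+y. ennreal (exp (l * (f (x(i := y)) - ?E))) \<partial>N i \<partial>PiM I N)"
    unfolding Ef by (intro product_nn_integral_insert insert.hyps) measurable
  also have "\<dots> \<le> (\<integral>\<^sup>+x. ennreal (exp (l * (g x - ?E))) * ennreal (exp (l\<^sup>2 * c\<^sup>2 / 8)) \<partial>PiM I N)"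
  proof (intro nn_integral_mono)
    fix x assume x: "x \<in> space (PiM I N)"
    \<comment> \<open>The exponent is split at \<open>g x\<close>: the part \<open>g x - ?E\<close>
      is constant in \<open>y\<close>, and \<open>g x\<close> is the mean of the slice, as
      Hoeffding's lemma requires.\<close>
    have "(\<integral>\<^sup>+y. ennreal (exp (l * (f (x(i := y)) - ?E))) \<partial>N i) =
        (\<integral>\<^sup>+y. ennreal (exp (l * (g x - ?E))) * ennreal (exp (l * (f (x(i := y)) - g x))) \<partial>N i)"
      by (intro nn_integral_cong) (simp add: exp_add[symmetric] ennreal_mult'[symmetric] algebra_simps)
    also have "\<dots> = ennreal (exp (l * (g x - ?E))) * (\<integral>\<^sup>+y. ennreal (exp (l * (f (x(i := y)) - g x))) \<partial>N i)"
    proof (intro nn_integral_cmult)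
      note [measurable] = slice[OF x]
      show "(\<lambda>y. ennreal (exp (l * (f (x(i := y)) - g x)))) \<in> borel_measurable (N i)" by measurable
    qed
    also have "(\<integral>\<^sup>+y. ennreal (exp (l * (f (x(i := y)) - g x))) \<partial>N i) \<le> ennreal (exp (l\<^sup>2 * c\<^sup>2 / 8))"
      unfolding g_def
    proof (rule Ni.Hoeffdings_lemma_oscillation[OF slice[OF x] \<open>l > 0\<close>])
      fix y z assume "y \<in> space (N i)" "z \<in> space (N i)"
      then show "\<bar>f (x(i := y)) - f (x(i := z))\<bar> \<le> c"
        using insert.prems(3)[OF upd[OF x], of z i y] by (simp del: fun_upd_apply)
    qed
    finally show "(\<integral>\<^sup>+y. ennreal (exp (l * (f (x(i := y)) - ?E))) \<partial>N i) \<le>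
        ennreal (exp (l * (g x - ?E))) * ennreal (exp (l\<^sup>2 * c\<^sup>2 / 8))"
      by (simp add: mult_left_mono)
  qed
  also have "\<dots> = (\<integral>\<^sup>+x. ennreal (exp (l * (g x - ?E))) \<partial>PiM I N) * ennreal (exp (l\<^sup>2 * c\<^sup>2 / 8))"
    by (intro nn_integral_multc) measurable
  also have "\<dots> \<le> ennreal (exp (real (card I) * (l\<^sup>2 * c\<^sup>2 / 8))) * ennreal (exp (l\<^sup>2 * c\<^sup>2 / 8))"
    using insert.IH[OF g_meas g_bound g_diff] by (intro mult_right_mono) auto
  also have "\<dots> = ennreal (exp (real (card (insert i I)) * (l\<^sup>2 * c\<^sup>2 / 8)))"
    using insert.hyps by (simp add: ennreal_mult'[symmetric] exp_add[symmetric] algebra_simps)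
  finally show ?case .
qed

lemma bounded_differences_inequality:
  fixes f :: "('i \<Rightarrow> 'a) \<Rightarrow> real"
  assumes N: "\<And>i. prob_space (N i)" and I: "finite I" "I \<noteq> {}" and "\<epsilon> > 0"
    and f [measurable]: "f \<in> borel_measurable (PiM I N)"
    and C: "\<And>x. x \<in> space (PiM I N) \<Longrightarrow> \<bar>f x\<bar> \<le> C"
    and diff: "\<And>x i y. x \<in> space (PiM I N) \<Longrightarrow> i \<in> I \<Longrightarrow> y \<in> space (N i) \<Longrightarrow> \<bar>f (x(i := y)) - f x\<bar> \<le> 1"
  shows "measure (PiM I N) {x \<in> space (PiM I N). \<bar>f x - (\<integral>x. f x \<partial>PiM I N)\<bar> \<ge> \<epsilon>}
    \<le> 2 * exp (- 2 * \<epsilon>\<^sup>2 / real (card I))"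
proof -
  interpret prob_space "PiM I N" by (intro prob_space_PiM N)
  let ?n = "real (card I)"
  have n: "?n > 0" using I by (simp add: card_gt_0_iff)
  \<comment> \<open>This value minimizes the Chernoff exponent
    \<open>- l * \<epsilon> + ?n * l\<^sup>2 / 8\<close>; the minimum is
    \<open>- 2 * \<epsilon>\<^sup>2 / ?n\<close>.\<close>
  define l where "l = 4 * \<epsilon> / ?n"
  have "l > 0" using n \<open>\<epsilon> > 0\<close> by (simp add: l_def)
  \<comment> \<open>The upper tail is bounded for a general \<open>h\<close>, to be applied to
    \<open>f\<close> and to its negative.\<close>
  have *: "prob {x \<in> space (PiM I N). h x - expectation h \<ge> \<epsilon>} \<le> exp (- 2 * \<epsilon>\<^sup>2 / ?n)"
    if [measurable]: "h \<in> borel_measurable (PiM I N)"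
      and "\<And>x. x \<in> space (PiM I N) \<Longrightarrow> \<bar>h x\<bar> \<le> C"
      and "\<And>x i y. x \<in> space (PiM I N) \<Longrightarrow> i \<in> I \<Longrightarrow> y \<in> space (N i) \<Longrightarrow> \<bar>h (x(i := y)) - h x\<bar> \<le> 1"
    for h
  proof -
    have "emeasure (PiM I N) {x \<in> space (PiM I N). h x - expectation h \<ge> \<epsilon>} \<le>
        ennreal (exp (- l * \<epsilon>)) *
        (\<integral>\<^sup>+x. ennreal (exp (l * (h x - expectation h))) * indicator (space (PiM I N)) x \<partial>PiM I N)"
      by (intro Chernoff_ineq_nn_integral_ge \<open>l > 0\<close>) measurable
    also have "(\<integral>\<^sup>+x. ennreal (exp (l * (h x - expectation h))) * indicator (space (PiM I N)) x \<partial>PiM I N) =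
        (\<integral>\<^sup>+x. ennreal (exp (l * (h x - expectation h))) \<partial>PiM I N)"
      by (intro nn_integral_cong) auto
    also have "\<dots> \<le> ennreal (exp (?n * (l\<^sup>2 * 1\<^sup>2 / 8)))"
      using that by (intro bounded_differences_mgf N I(1) \<open>l > 0\<close>)
    also have "ennreal (exp (- l * \<epsilon>)) * ennreal (exp (?n * (l\<^sup>2 * 1\<^sup>2 / 8))) =
        ennreal (exp (- l * \<epsilon> + ?n * (l\<^sup>2 * 1\<^sup>2 / 8)))"
      by (simp add: ennreal_mult'[symmetric] exp_add[symmetric])
    also have "- l * \<epsilon> + ?n * (l\<^sup>2 * 1\<^sup>2 / 8) = - 2 * \<epsilon>\<^sup>2 / ?n"
      using n by (simp add: l_def field_simps power2_eq_square)
    finally show ?thesis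
      by (simp add: emeasure_eq_measure mult_left_mono)
  qed
  have "prob {x \<in> space (PiM I N). \<bar>f x - expectation f\<bar> \<ge> \<epsilon>} \<le>
      prob ({x \<in> space (PiM I N). f x - expectation f \<ge> \<epsilon>} \<union>
        {x \<in> space (PiM I N). (- f x) - expectation (\<lambda>x. - f x) \<ge> \<epsilon>})"
    by (intro finite_measure_mono) auto
  also have "\<dots> \<le> prob {x \<in> space (PiM I N). f x - expectation f \<ge> \<epsilon>} +
      prob {x \<in> space (PiM I N). (- f x) - expectation (\<lambda>x. - f x) \<ge> \<epsilon>}"
    by (intro measure_Un_le) measurable
  also have "\<dots> \<le> exp (- 2 * \<epsilon>\<^sup>2 / ?n) + exp (- 2 * \<epsilon>\<^sup>2 / ?n)"
    using C diff by (intro add_mono *) (auto simp: abs_minus_commute)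
  finally show ?thesis by simp
qed

section \<open>Void probabilities of Poisson and uniform samples\<close>

lemma pmf_nat_has_integral_sums:
  fixes p :: "nat pmf" and f :: "nat \<Rightarrow> real"
  assumes "\<And>n. 0 \<le> f n" and s: "(\<lambda>n. pmf p n * f n) sums s"
  shows "has_bochner_integral (measure_pmf p) f s"
proof (rule has_bochner_integral_nn_integral)
  have nn: "0 \<le> pmf p n * f n" for n using assms(1) by (simp add: pmf_nonneg)
  show "0 \<le> s" using nn s by (rule sums_le[OF _ sums_zero])
  have "(\<integral>\<^sup>+n. ennreal (f n) \<partial>measure_pmf p) = (\<Sum>n. ennreal (pmf p n * f n))"
    unfolding nn_integral_measure_pmf nn_integral_count_space_nat
    using assms(1) by (simp add: ennreal_mult pmf_nonneg)
  also have "\<dots> = ennreal s" using nn s by (rule suminf_ennreal_eq)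
  finally show "(\<integral>\<^sup>+n. ennreal (f n) \<partial>measure_pmf p) = ennreal s" .
qed (use assms in auto)

text \<open>This is the probability generating function of the Poisson law. With \<open>u\<close>
  the chance that one point avoids a set, it yields the void probability of a Poisson number of
  independent points.\<close>

lemma poisson_has_integral_power:
  fixes u :: real
  assumes "0 < lam" "0 \<le> u"
  shows "has_bochner_integral (measure_pmf (poisson_pmf lam)) (\<lambda>n. u ^ n) (exp (- (lam * (1 - u))))"
proof (rule pmf_nat_has_integral_sums)
  have "(\<lambda>n. exp (- lam) * ((lam * u) ^ n /\<^sub>R fact n)) sums (exp (- lam) * exp (lam * u))"
    by (intro sums_mult exp_converges)
  then show "(\<lambda>n. pmf (poisson_pmf lam) n * u ^ n) sums exp (- (lam * (1 - u)))"
    using assms by (simp add: field_simps power_mult_distrib exp_add[symmetric] exp_diff exp_minus)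
qed (use assms in auto)

lemma
  assumes lam: "0 < lam"
  shows poisson_has_integral_first: "has_bochner_integral (measure_pmf (poisson_pmf lam)) real lam"
    and poisson_has_integral_second:
      "has_bochner_integral (measure_pmf (poisson_pmf lam)) (\<lambda>n. (real n)\<^sup>2) (lam\<^sup>2 + lam)"
proof -
  let ?p = "pmf (poisson_pmf lam)"
  \<comment> \<open>This recursion turns the total mass into the first moment and, after one more
    factor \<open>real (Suc n)\<close>, the mass and the first moment into the second. The terms at
    0 vanish, so the shifted series have the same sums.\<close>
  have Suc: "?p (Suc n) * real (Suc n) = lam * ?p n" for n
    using lam by (simp add: divide_simps fact_Suc del: of_nat_Suc)
  have "(\<lambda>n. ?p n) sums 1"
    using sums_mult[OF exp_converges[of lam], of "exp (- lam)"] lam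
    by (simp add: field_simps exp_minus)
  then have "(\<lambda>n. lam * ?p n) sums lam" using sums_mult[of ?p 1 lam] by simp
  then have first: "(\<lambda>n. ?p n * real n) sums lam"
    unfolding Suc[symmetric] using sums_Suc_imp[of "\<lambda>n. ?p n * real n" lam] by simp
  then have "(\<lambda>n. lam * (?p n * real n) + lam * ?p n) sums (lam * lam + lam)"
    using \<open>(\<lambda>n. lam * ?p n) sums lam\<close> by (intro sums_add sums_mult)
  moreover have "lam * (?p n * real n) + lam * ?p n = ?p (Suc n) * (real (Suc n))\<^sup>2" for n
    using arg_cong[OF Suc[of n], of "\<lambda>z. z * real (Suc n)"] by (simp add: power2_eq_square algebra_simps)
  ultimately have "(\<lambda>n. ?p (Suc n) * (real (Suc n))\<^sup>2) sums (lam\<^sup>2 + lam)"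
    by (simp add: power2_eq_square)
  then have "(\<lambda>n. ?p n * (real n)\<^sup>2) sums (lam\<^sup>2 + lam)"
    using sums_Suc_imp[of "\<lambda>n. ?p n * (real n)\<^sup>2"] by simp
  then show "has_bochner_integral (measure_pmf (poisson_pmf lam)) (\<lambda>n. (real n)\<^sup>2) (lam\<^sup>2 + lam)"
    by (intro pmf_nat_has_integral_sums) auto
  show "has_bochner_integral (measure_pmf (poisson_pmf lam)) real lam"
    using first by (intro pmf_nat_has_integral_sums) auto
qed

text \<open>The variance equals \<open>lam\<close>. The arithmetic-geometric mean inequality,
  balanced at \<open>s = sqrt lam\<close>, does the work of the Cauchy-Schwarz inequality.\<close>

lemma poisson_mean_deviation:
  assumes lam: "0 < lam"
  shows "integrable (measure_pmf (poisson_pmf lam)) (\<lambda>n. \<bar>real n - lam\<bar>)"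
    and "(\<integral>n. \<bar>real n - lam\<bar> \<partial>measure_pmf (poisson_pmf lam)) \<le> sqrt lam"
proof -
  let ?M = "measure_pmf (poisson_pmf lam)"
  note 1 = poisson_has_integral_first[OF lam] and 2 = poisson_has_integral_second[OF lam]
  have [simp]: "integrable ?M real" "integrable ?M (\<lambda>n. (real n)\<^sup>2)"
    using 1 2 by (auto simp: has_bochner_integral_iff)
  note int = has_bochner_integral_integral_eq[OF 1] has_bochner_integral_integral_eq[OF 2]
  show "integrable ?M (\<lambda>n. \<bar>real n - lam\<bar>)"
    using integrable_abs[of ?M "\<lambda>n. real n - lam"] by simp
  define s where "s = sqrt lam"
  have s: "s > 0" "s\<^sup>2 = lam" using lam by (auto simp: s_def)
  have "\<bar>x\<bar> \<le> (x\<^sup>2 / s + s) / 2" for x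
  proof -
    have "0 \<le> (\<bar>x\<bar> - s)\<^sup>2" by simp
    then show ?thesis using s(1) by (simp add: field_simps power2_eq_square)
  qed
  then have "(\<integral>n. \<bar>real n - lam\<bar> \<partial>?M) \<le> (\<integral>n. ((real n - lam)\<^sup>2 / s + s) / 2 \<partial>?M)"
    by (intro integral_mono \<open>integrable ?M (\<lambda>n. \<bar>real n - lam\<bar>)\<close>) (simp add: power2_diff, blast)
  also have "\<dots> = ((\<integral>n. (real n - lam)\<^sup>2 \<partial>?M) / s + s) / 2"
    by (simp add: power2_diff)
  also have "(\<integral>n. (real n - lam)\<^sup>2 \<partial>?M) = s\<^sup>2"
    by (simp add: power2_diff int s) (simp add: power2_eq_square)
  also have "(s\<^sup>2 / s + s) / 2 = s" using s(1) by (simp add: power2_eq_square)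
  finally show "(\<integral>n. \<bar>real n - lam\<bar> \<partial>?M) \<le> sqrt lam" by (simp add: s_def)
qed

section \<open>Uniform points in the unit cube\<close>

abbreviation uniform_cube :: "(real ^ 'd) measure" where
  "uniform_cube \<equiv> uniform_measure lborel (cube 1)"

text \<open>The summand \<open>0\<close> exhibits the cube as an instance of the boxes
  \<open>cbox v (v + (\<chi> i. t))\<close> that serve as tiles.\<close>

lemma cube_eq_box: "(cube t :: (real ^ 'd) set) = cbox 0 (0 + (\<chi> i. t))"
  by (simp add: cube_def)

lemma emeasure_box:
  fixes v :: "real ^ 'd"
  assumes "0 \<le> t"
  shows "emeasure lborel (cbox v (v + (\<chi> i. t))) = ennreal (t ^ CARD('d))"
proof -
  have "emeasure lborel (cbox v (v + (\<chi> i. t))) = ennreal (\<Prod>b\<in>Basis. (\<chi> i. t) \<bullet> (b :: real ^ 'd))"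
    using assms by (subst emeasure_lborel_cbox) (auto simp: inner_add_left Basis_vec_def inner_axis)
  also have "(\<Prod>b\<in>Basis. (\<chi> i. t) \<bullet> (b :: real ^ 'd)) = (\<Prod>b\<in>(Basis :: (real ^ 'd) set). t)"
    by (intro prod.cong) (auto simp: Basis_vec_def inner_axis)
  finally show ?thesis by simp
qed

lemma prob_space_uniform_cube: "prob_space (uniform_cube :: (real ^ 'd) measure)"
  using emeasure_box[of 1 "0 :: real ^ 'd"]
  by (intro prob_space_uniform_measure) (auto simp: cube_eq_box)

lemma measure_uniform_cube:
  "A \<in> sets borel \<Longrightarrow> measure uniform_cube A = measure lborel (cube 1 \<inter> A :: (real ^ 'd) set)"
  using emeasure_box[of 1 "0 :: real ^ 'd"]
  by (subst measure_uniform_measure) (auto simp: cube_eq_box measure_def)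

text \<open>The map \<open>x \<mapsto> v + t *\<^sub>R x\<close> carries the unit cube onto the box
  and multiplies Lebesgue measure by the factor \<open>t ^ CARD('d)\<close>. The intensity measure
  in a box thus becomes a multiple of the uniform law.\<close>

lemma measure_uniform_cube_affine:
  fixes v :: "real ^ 'd"
  assumes t: "0 < t" and A: "A \<in> sets borel"
  shows "measure lborel (cbox v (v + (\<chi> i. t)) \<inter> A) =
    t ^ CARD('d) * measure uniform_cube {x. v + t *\<^sub>R x \<in> A}"
proof -
  let ?f = "\<lambda>x. v + t *\<^sub>R x" and ?W = "cbox v (v + (\<chi> i. t))"
  have meas: "{x. ?f x \<in> A} \<in> sets borel"
    using A measurable_sets_borel[of ?f borel A] by (simp add: vimage_def)
  have "emeasure lborel (?W \<inter> A) =
      emeasure (density (distr lborel borel ?f) (\<lambda>_. ennreal (\<bar>t\<bar> ^ DIM(real ^ 'd)))) (?W \<inter> A)"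
    using lborel_affine[of t v] t by simp
  also have "\<dots> = ennreal (t ^ CARD('d)) * emeasure lborel (?f -` (?W \<inter> A))"
    using A t by (simp add: emeasure_density nn_integral_cmult_indicator emeasure_distr)
  also have "?f -` (?W \<inter> A) = cube 1 \<inter> {x. ?f x \<in> A}"
    using t by (auto simp: cube_def mem_box_cart zero_le_mult_iff)
  finally show ?thesis
    using t by (simp add: measure_uniform_cube[OF meas]) (simp add: measure_def enn2real_mult)
qed

lemma random_finite_set_image:
  fixes Z :: "nat \<Rightarrow> 'w \<Rightarrow> 'a :: topological_space"
  assumes "\<And>i. i < n \<Longrightarrow> Z i \<in> borel_measurable M"
  shows "random_finite_set M (\<lambda>\<omega>. (\<lambda>i. Z i \<omega>) ` {..<n})"
  unfolding random_finite_set_def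
proof (intro conjI ballI)
  fix A :: "'a set" assume [measurable]: "A \<in> sets borel"
  have "{\<omega> \<in> space M. Z i \<omega> \<notin> A} \<in> sets M" if "i \<in> {..<n}" for i
  proof -
    have [measurable]: "Z i \<in> borel_measurable M" using assms that by simp
    show ?thesis by measurable
  qed
  then have "{\<omega> \<in> space M. \<forall>i\<in>{..<n}. Z i \<omega> \<notin> A} \<in> sets M"
    by (intro sets.sets_Collect_finite_All) auto
  also have "{\<omega> \<in> space M. \<forall>i\<in>{..<n}. Z i \<omega> \<notin> A} =
      {\<omega> \<in> space M. (\<lambda>i. Z i \<omega>) ` {..<n} \<inter> A = {}}" by auto
  finally show "{\<omega> \<in> space M. (\<lambda>i. Z i \<omega>) ` {..<n} \<inter> A = {}} \<in> sets M" .
qed auto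

lemma random_finite_set_image_random:
  fixes Z :: "nat \<Rightarrow> 'w \<Rightarrow> 'a :: topological_space"
  assumes [measurable]: "\<And>i. Z i \<in> borel_measurable M" "K \<in> measurable M (count_space UNIV)"
  shows "random_finite_set M (\<lambda>\<omega>. (\<lambda>i. Z i \<omega>) ` {..<K \<omega>})"
  unfolding random_finite_set_def
proof (intro conjI ballI)
  fix A :: "'a set" assume [measurable]: "A \<in> sets borel"
  have "{\<omega> \<in> space M. (\<lambda>i. Z i \<omega>) ` {..<K \<omega>} \<inter> A = {}} = {\<omega> \<in> space M. \<forall>i. i < K \<omega> \<longrightarrow> Z i \<omega> \<notin> A}"
    by auto
  also have "\<dots> \<in> sets M" by measurable
  finally show "{\<omega> \<in> space M. (\<lambda>i. Z i \<omega>) ` {..<K \<omega>} \<inter> A = {}} \<in> sets M" .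
qed auto

text \<open>Adjacency by a weak inequality is a closed relation, which is what the approximation by
  cells asks for.\<close>

lemma closed_dist_le: "closed {(u, v). dist u v \<le> (r :: real)}"
  by (auto simp: split_beta' intro!: closed_Collect_le continuous_intros)

text \<open>The index set is left open: the finite product is needed for the bounded differences
  inequality, the infinite one for samples of random size.\<close>

lemma void_product:
  fixes I :: "nat set" and A :: "(real ^ 'd) set"
  assumes "{..<n} \<subseteq> I" and [measurable]: "A \<in> sets borel"
  shows "measure (PiM I (\<lambda>_. uniform_cube)) {x \<in> space (PiM I (\<lambda>_. uniform_cube)). x ` {..<n} \<inter> A = {}}
    = (1 - measure uniform_cube A) ^ n"
proof -
  interpret U: prob_space "uniform_cube :: (real ^ 'd) measure" by (rule prob_space_uniform_cube)
  interpret product_prob_space "\<lambda>_. uniform_cube :: (real ^ 'd) measure" I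
    by (intro product_prob_spaceI prob_space_uniform_cube)
  let ?S = "PiM I (\<lambda>_. uniform_cube :: (real ^ 'd) measure)"
  have "{x \<in> space ?S. x ` {..<n} \<inter> A = {}} = {x \<in> space ?S. \<forall>i\<in>{..<n}. x i \<in> - A}" by auto
  also have "emeasure ?S \<dots> = (\<Prod>i<n. emeasure uniform_cube (- A))"
    using assms(1) by (intro emeasure_PiM_Collect) auto
  finally have "emeasure ?S {x \<in> space ?S. x ` {..<n} \<inter> A = {}} = emeasure uniform_cube (- A) ^ n"
    by simp
  then have "measure ?S {x \<in> space ?S. x ` {..<n} \<inter> A = {}} = measure uniform_cube (- A) ^ n"
    by (simp add: emeasure_eq_measure U.emeasure_eq_measure ennreal_power)
  also have "measure uniform_cube (- A) = 1 - measure uniform_cube A"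
    using U.prob_compl[of A] by (simp add: Compl_eq_Diff_UNIV)
  finally show ?thesis .
qed

lemma void_iid:
  fixes Y :: "nat \<Rightarrow> 'w \<Rightarrow> real ^ 'd"
  assumes "prob_space M" "iid_uniform_points M n Y" "0 < n" and [measurable]: "A \<in> sets borel"
  shows "measure M {\<omega> \<in> space M. (\<lambda>i. Y i \<omega>) ` {..<n} \<inter> A = {}} = (1 - measure uniform_cube A) ^ n"
proof -
  interpret prob_space M by fact
  interpret U: prob_space "uniform_cube :: (real ^ 'd) measure" by (rule prob_space_uniform_cube)
  have ind: "indep_vars (\<lambda>_. borel) Y {..<n}"
    and law: "\<And>i. i < n \<Longrightarrow> distr M borel (Y i) = uniform_cube"
    using assms(2) by (auto simp: iid_uniform_points_def)
  have Y: "Y i \<in> borel_measurable M" if "i < n" for i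
    using ind that by (simp add: indep_vars_def)
  \<comment> \<open>The index set must be nonempty: an empty intersection would be
    \<open>UNIV\<close> rather than \<open>space M\<close>.\<close>
  have "{\<omega> \<in> space M. (\<lambda>i. Y i \<omega>) ` {..<n} \<inter> A = {}} = (\<Inter>i\<in>{..<n}. Y i -` (- A) \<inter> space M)"
    using \<open>0 < n\<close> by auto
  also have "prob \<dots> = (\<Prod>i<n. prob (Y i -` (- A) \<inter> space M))"
    using \<open>0 < n\<close> by (intro indep_varsD[OF ind]) auto
  also have "\<dots> = (\<Prod>i<n. measure uniform_cube (- A))"
    using Y by (intro prod.cong refl) (simp add: law[symmetric] measure_distr)
  also have "measure uniform_cube (- A) = 1 - measure uniform_cube A"
    using U.prob_compl[of A] by (simp add: Compl_eq_Diff_UNIV)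
  finally show ?thesis by simp
qed

abbreviation iid_sample :: "(nat \<Rightarrow> real ^ 'd) measure" where
  "iid_sample \<equiv> PiM UNIV (\<lambda>_. uniform_cube)"

lemma prob_space_iid_sample: "prob_space (iid_sample :: (nat \<Rightarrow> real ^ 'd) measure)"
  by (intro prob_space_PiM prob_space_uniform_cube)

abbreviation maxcol_dist :: "nat \<Rightarrow> real \<Rightarrow> 'v :: metric_space set \<Rightarrow> nat" where
  "maxcol_dist k r \<equiv> maxcol k (\<lambda>u v. dist u v \<le> r)"

text \<open>Scaling by \<open>t\<close> trades radius 1 in a box of side \<open>t\<close> for radius
  \<open>1 / t\<close> in the unit cube, which links \<open>F_count\<close> to
  \<open>H_ratio\<close>.\<close>

lemma maxcol_dist_affine:
  fixes v :: "'v :: real_normed_vector"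
  assumes "0 < t"
  shows "maxcol_dist k 1 ((\<lambda>x. v + t *\<^sub>R x) ` V) = maxcol_dist k (1 / t) V"
proof (rule maxcol_image)
  show "inj_on (\<lambda>x. v + t *\<^sub>R x) V" using assms by (auto simp: inj_on_def)
  have "dist (v + t *\<^sub>R x) (v + t *\<^sub>R y) = t * dist x y" for x y
    using assms by (simp add: dist_norm flip: scaleR_diff_right)
  then show "dist (v + t *\<^sub>R x) (v + t *\<^sub>R y) \<le> 1 \<longleftrightarrow> dist x y \<le> 1 / t" for x y
    using assms by (simp add: field_simps)
qed

text \<open>All \<open>n\<close> share one infinite sequence of points, so the samples of different
  sizes are nested. The type argument \<open>T\<close> only carries the dimension.\<close>

definition mean_maxcol :: "'d::finite itself \<Rightarrow> nat \<Rightarrow> real \<Rightarrow> nat \<Rightarrow> real" where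
  "mean_maxcol T k r n =
    (\<integral>x. real (maxcol_dist k r (x ` {..<n})) \<partial>(iid_sample :: (nat \<Rightarrow> real ^ 'd) measure))"

section \<open>Concentration and Poissonization\<close>

lemma measurable_maxcol_dist:
  fixes V :: "'w \<Rightarrow> 'a :: {second_countable_topology, metric_space} set"
  assumes "random_finite_set M V"
  shows "(\<lambda>\<omega>. maxcol_dist k r (V \<omega>)) \<in> measurable M (count_space UNIV)"
  using assms by (intro measurable_maxcol closed_dist_le)

lemma random_finite_set_product:
  fixes I :: "nat set"
  assumes "{..<n} \<subseteq> I"
  shows "random_finite_set (PiM I (\<lambda>_. uniform_cube :: (real ^ 'd) measure)) (\<lambda>x. x ` {..<n})"
  by (intro random_finite_set_image measurable_compose[OF measurable_component_singleton])
    (use assms in auto)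

lemma measurable_iid_uniform_points:
  "iid_uniform_points M n Y \<Longrightarrow> prob_space M \<Longrightarrow> i < n \<Longrightarrow> Y i \<in> borel_measurable M"
  by (simp add: iid_uniform_points_def prob_space.indep_vars_def)

lemma random_finite_set_iid:
  "iid_uniform_points M n Y \<Longrightarrow> prob_space M \<Longrightarrow> random_finite_set M (\<lambda>\<omega>. (\<lambda>i. Y i \<omega>) ` {..<n})"
  by (intro random_finite_set_image measurable_iid_uniform_points)

lemma distr_maxcol_product:
  fixes I J :: "nat set"
  assumes "{..<n} \<subseteq> I" "{..<n} \<subseteq> J"
  shows "distr (PiM I (\<lambda>_. uniform_cube :: (real ^ 'd) measure)) (count_space UNIV)
      (\<lambda>x. maxcol_dist k r (x ` {..<n})) =
    distr (PiM J (\<lambda>_. uniform_cube :: (real ^ 'd) measure)) (count_space UNIV)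
      (\<lambda>x. maxcol_dist k r (x ` {..<n}))"
  using assms
  by (intro distr_maxcol_eq closed_dist_le random_finite_set_product prob_space_PiM
      prob_space_uniform_cube) (simp_all add: void_product)

text \<open>Both samples have the same void probabilities, so the given points may be replaced by
  the coordinates of a product space.\<close>

lemma distr_maxcol_iid:
  fixes Y :: "nat \<Rightarrow> 'w \<Rightarrow> real ^ 'd" and I :: "nat set"
  assumes "prob_space M" "iid_uniform_points M n Y" "0 < n" "{..<n} \<subseteq> I"
  shows "distr M (count_space UNIV) (\<lambda>\<omega>. maxcol_dist k r ((\<lambda>i. Y i \<omega>) ` {..<n})) =
    distr (PiM I (\<lambda>_. uniform_cube :: (real ^ 'd) measure)) (count_space UNIV)
      (\<lambda>x. maxcol_dist k r (x ` {..<n}))"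
  using assms
  by (intro distr_maxcol_eq closed_dist_le random_finite_set_product random_finite_set_iid
      prob_space_PiM prob_space_uniform_cube) (simp_all add: void_product void_iid)

lemma integral_count_distr_cong:
  fixes f :: "'a \<Rightarrow> nat" and g :: "'b \<Rightarrow> nat"
  assumes "distr M (count_space UNIV) f = distr N (count_space UNIV) g"
    and "f \<in> measurable M (count_space UNIV)" "g \<in> measurable N (count_space UNIV)"
  shows "(\<integral>x. real (f x) \<partial>M) = (\<integral>x. real (g x) \<partial>N)"
    and "integrable M (\<lambda>x. real (f x)) \<longleftrightarrow> integrable N (\<lambda>x. real (g x))"
  using assms integral_distr[of f M "count_space UNIV" real] integral_distr[of g N "count_space UNIV" real]
    integrable_distr_eq[of f M "count_space UNIV" real] integrable_distr_eq[of g N "count_space UNIV" real]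
  by simp_all

lemma mean_maxcol_product:
  assumes "{..<n} \<subseteq> I"
  shows "(\<integral>x. real (maxcol_dist k r (x ` {..<n})) \<partial>PiM I (\<lambda>_. uniform_cube :: (real ^ 'd) measure)) =
    mean_maxcol TYPE('d) k r n"
  unfolding mean_maxcol_def using assms
  by (intro integral_count_distr_cong distr_maxcol_product measurable_maxcol_dist
      random_finite_set_product) auto

lemma maxcol_le_insert: "finite S \<Longrightarrow> T \<subseteq> insert y S \<Longrightarrow> maxcol k R T \<le> maxcol k R S + 1"
proof -
  assume "finite S" "T \<subseteq> insert y S"
  then have "maxcol k R T \<le> maxcol k R (S \<union> {y})" by (intro maxcol_mono) auto
  also have "\<dots> \<le> maxcol k R S + maxcol k R {y}" using \<open>finite S\<close> by (intro maxcol_Un) auto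
  also have "maxcol k R {y} \<le> 1" using maxcol_le_card[of "{y}" k R] by simp
  finally show ?thesis by simp
qed

lemma maxcol_image_le: "maxcol k R (f ` {..<n}) \<le> (n :: nat)"
  using maxcol_le_card[of "f ` {..<n}" k R] card_image_le[of "{..<n}" f] by simp

text \<open>Moving one point changes the colouring number by at most 1, whatever the radius. The
  bounded differences inequality then gives a bound that does not depend on \<open>r\<close> and is
  geometric in \<open>n\<close>.\<close>

lemma maxcol_concentration:
  fixes Y :: "nat \<Rightarrow> 'w \<Rightarrow> real ^ 'd"
  assumes M: "prob_space M" "iid_uniform_points M n Y" and n: "0 < n" and "\<epsilon> > 0"
  shows "measure M {\<omega> \<in> space M. \<bar>real (maxcol_dist k r ((\<lambda>i. Y i \<omega>) ` {..<n})) - mean_maxcol TYPE('d) k r n\<bar>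
      \<ge> \<epsilon> * real n} \<le> 2 * exp (- 2 * \<epsilon>\<^sup>2) ^ n"
proof -
  let ?U = "\<lambda>_ :: nat. uniform_cube :: (real ^ 'd) measure"
  let ?S = "PiM {..<n} ?U"
  let ?h = "mean_maxcol TYPE('d) k r n"
  define f where "f x = real (maxcol_dist k r (x ` {..<n}))" for x :: "nat \<Rightarrow> real ^ 'd"
  let ?B = "{m. \<bar>real m - ?h\<bar> \<ge> \<epsilon> * real n}"
  have meas: "(\<lambda>x. maxcol_dist k r (x ` {..<n})) \<in> measurable ?S (count_space UNIV)"
    by (intro measurable_maxcol_dist random_finite_set_product) simp
  have measM: "(\<lambda>\<omega>. maxcol_dist k r ((\<lambda>i. Y i \<omega>) ` {..<n})) \<in> measurable M (count_space UNIV)"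
    using M by (intro measurable_maxcol_dist random_finite_set_iid)
  have "measure M {\<omega> \<in> space M. \<bar>real (maxcol_dist k r ((\<lambda>i. Y i \<omega>) ` {..<n})) - ?h\<bar> \<ge> \<epsilon> * real n} =
      measure (distr M (count_space UNIV) (\<lambda>\<omega>. maxcol_dist k r ((\<lambda>i. Y i \<omega>) ` {..<n}))) ?B"
    using measM by (simp add: measure_distr vimage_def Int_def conj_commute)
  also have "\<dots> = measure (distr ?S (count_space UNIV) (\<lambda>x. maxcol_dist k r (x ` {..<n}))) ?B"
    using distr_maxcol_iid[OF M n subset_refl] by metis
  also have "\<dots> = measure ?S {x \<in> space ?S. \<bar>f x - (\<integral>x. f x \<partial>?S)\<bar> \<ge> \<epsilon> * real n}"
    unfolding f_def mean_maxcol_product[OF subset_refl]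
    using meas by (simp add: measure_distr vimage_def Int_def conj_commute)
  also have "\<dots> \<le> 2 * exp (- 2 * (\<epsilon> * real n)\<^sup>2 / real (card {..<n}))"
  proof (rule bounded_differences_inequality[where C = "real n"])
    show "f \<in> borel_measurable ?S"
      unfolding f_def using meas by (rule measurable_compose) simp
    show "\<bar>f x\<bar> \<le> real n" for x
      by (simp add: f_def maxcol_image_le)
    show "\<bar>f (x(i := y)) - f x\<bar> \<le> 1" if "i \<in> {..<n}" for x i y
    proof -
      \<comment> \<open>Each of the two images is contained in the other one with a single point
        added, so one insertion bound gives both directions.\<close>
      have "maxcol_dist k r (x(i := y) ` {..<n}) \<le> maxcol_dist k r (x ` {..<n}) + 1"
        by (rule maxcol_le_insert[of _ _ y]) auto
      moreover have "maxcol_dist k r (x ` {..<n}) \<le> maxcol_dist k r (x(i := y) ` {..<n}) + 1"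
        by (rule maxcol_le_insert[of _ _ "x i"]) (auto simp: image_iff)
      ultimately show ?thesis by (simp add: f_def abs_le_iff del: fun_upd_apply)
    qed
  qed (use n \<open>\<epsilon> > 0\<close> prob_space_uniform_cube in auto)
  also have "- 2 * (\<epsilon> * real n)\<^sup>2 / real (card {..<n}) = real n * (- 2 * \<epsilon>\<^sup>2)"
    using n by (simp add: power2_eq_square)
  finally show ?thesis by (simp only: exp_of_nat_mult)
qed

text \<open>The geometric bounds are summable, and the first Borel-Cantelli lemma asks for no
  independence between different \<open>n\<close>.\<close>

lemma AE_maxcol_deviation:
  fixes Y :: "nat \<Rightarrow> nat \<Rightarrow> 'w \<Rightarrow> real ^ 'd"
  assumes M: "prob_space M" and iid: "\<And>n. 0 < n \<Longrightarrow> iid_uniform_points M n (Y n)"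
  shows "AE \<omega> in M. (\<lambda>n. (real (maxcol_dist k (r n) ((\<lambda>i. Y n i \<omega>) ` {..<n})) -
      mean_maxcol TYPE('d) k (r n) n) / real n) \<longlonglongrightarrow> 0"
proof -
  interpret prob_space M by fact
  define D where "D n \<omega> = \<bar>real (maxcol_dist k (r n) ((\<lambda>i. Y n i \<omega>) ` {..<n})) -
      mean_maxcol TYPE('d) k (r n) n\<bar>" for n \<omega>
  have meas [measurable]: "D n \<in> borel_measurable M" if "0 < n" for n
  proof -
    have "(\<lambda>\<omega>. maxcol_dist k (r n) ((\<lambda>i. Y n i \<omega>) ` {..<n})) \<in> measurable M (count_space UNIV)"
      using that by (intro measurable_maxcol_dist random_finite_set_iid iid M)
    from measurable_compose[OF this, of "\<lambda>m. \<bar>real m - mean_maxcol TYPE('d) k (r n) n\<bar>" borel]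
    show ?thesis unfolding D_def by simp
  qed
  \<comment> \<open>The index is shifted by one because the samples are controlled for positive
    \<open>n\<close> only; \<open>LIMSEQ_imp_Suc\<close> undoes the shift.\<close>
  have small: "AE \<omega> in M. \<forall>\<^sub>F n in sequentially. D (Suc n) \<omega> < \<epsilon> * real (Suc n)" if "\<epsilon> > 0" for \<epsilon>
  proof -
    let ?A = "\<lambda>n. {\<omega> \<in> space M. D (Suc n) \<omega> \<ge> \<epsilon> * real (Suc n)}"
    have "summable (\<lambda>n. 2 * exp (- 2 * \<epsilon>\<^sup>2) ^ Suc n)"
      using \<open>\<epsilon> > 0\<close> by (intro summable_mult summable_ignore_initial_segment[of _ 1, simplified]
        summable_geometric) simp
    then have "summable (\<lambda>n. measure M (?A n))"
    proof (rule summable_comparison_test'[where N = 0])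
      show "norm (measure M (?A n)) \<le> 2 * exp (- 2 * \<epsilon>\<^sup>2) ^ Suc n" for n
        using maxcol_concentration[OF M iid, of "Suc n" \<epsilon>] \<open>\<epsilon> > 0\<close> by (simp add: D_def)
    qed
    then have "AE \<omega> in M. \<forall>\<^sub>F n in sequentially. \<omega> \<in> space M - ?A n"
      by (intro borel_cantelli_AE1) (auto simp: emeasure_eq_measure)
    then show ?thesis
      by eventually_elim (auto elim!: eventually_mono)
  qed
  \<comment> \<open>Restricting to the countably many thresholds \<open>1 / real (Suc m)\<close>
    leaves a single null set for all of them.\<close>
  have "AE \<omega> in M. \<forall>m. \<forall>\<^sub>F n in sequentially. D (Suc n) \<omega> < (1 / real (Suc m)) * real (Suc n)"
    unfolding AE_all_countable by (intro allI small) simp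
  then show ?thesis
  proof eventually_elim
    case (elim \<omega>)
    have "(\<lambda>n. D (Suc n) \<omega> / real (Suc n)) \<longlonglongrightarrow> 0"
    proof (rule LIMSEQ_I)
      fix e :: real assume "0 < e"
      then obtain m where m: "1 / real (Suc m) < e"
        using nat_approx_posE by (metis)
      have "\<forall>\<^sub>F n in sequentially. norm (D (Suc n) \<omega> / real (Suc n) - 0) < e"
        using elim[rule_format, of m]
      proof eventually_elim
        case (elim n)
        then have "D (Suc n) \<omega> / real (Suc n) < 1 / real (Suc m)" by (simp add: pos_divide_less_eq)
        then show ?case using m by (simp add: D_def)
      qed
      then show "\<exists>no. \<forall>n\<ge>no. norm (D (Suc n) \<omega> / real (Suc n) - 0) < e"
        by (simp add: eventually_sequentially)
    qed
    then have "(\<lambda>n. D n \<omega> / real n) \<longlonglongrightarrow> 0"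
      by (rule LIMSEQ_imp_Suc)
    then show ?case
      by (intro tendsto_rabs_zero_cancel[of "\<lambda>n. (real (maxcol_dist k (r n) ((\<lambda>i. Y n i \<omega>) ` {..<n})) -
        mean_maxcol TYPE('d) k (r n) n) / real n"]) (simp add: D_def)
  qed
qed

text \<open>Along one sequence, \<open>n - m\<close> further points never lower the colouring number
  and raise it by at most \<open>n - m\<close>. This holds pointwise and is then integrated.\<close>

lemma mean_maxcol_bounds: "0 \<le> mean_maxcol TYPE('d::finite) k r n" "mean_maxcol TYPE('d) k r n \<le> real n"
  and mean_maxcol_lipschitz: "\<bar>mean_maxcol TYPE('d) k r m - mean_maxcol TYPE('d) k r n\<bar> \<le> \<bar>real m - real n\<bar>"
proof -
  interpret S: prob_space "iid_sample :: (nat \<Rightarrow> real ^ 'd) measure" by (rule prob_space_iid_sample)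
  let ?f = "\<lambda>n x. real (maxcol_dist k r (x ` {..<n}))"
  have int: "integrable (iid_sample :: (nat \<Rightarrow> real ^ 'd) measure) (?f n)" for n
    by (intro S.integrable_const_bound[where B = "real n"] AE_I2
        measurable_compose[OF measurable_maxcol_dist[OF random_finite_set_product]])
      (auto simp: maxcol_image_le)
  show "0 \<le> mean_maxcol TYPE('d) k r n"
    by (simp add: mean_maxcol_def)
  have "mean_maxcol TYPE('d) k r n \<le> S.expectation (\<lambda>_. real n)"
    unfolding mean_maxcol_def using int by (intro integral_mono) (auto simp: maxcol_image_le)
  then show "mean_maxcol TYPE('d) k r n \<le> real n" by (simp add: S.prob_space)
  have *: "\<bar>mean_maxcol TYPE('d) k r m - mean_maxcol TYPE('d) k r n\<bar> \<le> \<bar>real m - real n\<bar>"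
    if "m \<le> n" for m n
  proof -
    have le: "?f m x \<le> ?f n x" for x :: "nat \<Rightarrow> real ^ 'd"
      using that by (auto intro!: maxcol_mono)
    have "?f n x \<le> ?f m x + (real n - real m)" for x :: "nat \<Rightarrow> real ^ 'd"
    proof -
      have "x ` {..<n} = x ` {..<m} \<union> x ` {m..<n}"
        using that by (simp add: image_Un[symmetric] ivl_disj_un)
      then have "maxcol_dist k r (x ` {..<n}) \<le> maxcol_dist k r (x ` {..<m}) + maxcol_dist k r (x ` {m..<n})"
        by (simp add: maxcol_Un)
      also have "maxcol_dist k r (x ` {m..<n}) \<le> n - m"
        using maxcol_le_card[of "x ` {m..<n}"] card_image_le[of "{m..<n}" x]
        by (metis card_atLeastLessThan finite_atLeastLessThan finite_imageI le_trans)
      finally show ?thesis using that by (simp add: of_nat_diff flip: of_nat_add)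
    qed
    then have "S.expectation (?f n) \<le> S.expectation (\<lambda>x. ?f m x + (real n - real m))"
      using int by (intro integral_mono) auto
    also have "\<dots> = S.expectation (?f m) + (real n - real m)"
      using int by (simp add: S.prob_space)
    finally have "S.expectation (?f n) \<le> S.expectation (?f m) + (real n - real m)" .
    moreover have "S.expectation (?f m) \<le> S.expectation (?f n)"
      using int le by (intro integral_mono)
    ultimately show ?thesis by (simp add: mean_maxcol_def)
  qed
  show "\<bar>mean_maxcol TYPE('d) k r m - mean_maxcol TYPE('d) k r n\<bar> \<le> \<bar>real m - real n\<bar>"
    using *[of m n] *[of n m] by (cases "m \<le> n") (auto simp: abs_minus_commute)
qed

section \<open>Samples of Poisson size\<close>

text \<open>The size is drawn independently of an infinite sequence, of which the first
  \<open>fst p\<close> points are kept. The sample space then does not vary with the size.\<close>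

abbreviation poissonized_sample :: "real \<Rightarrow> (nat \<times> (nat \<Rightarrow> real ^ 'd)) measure" where
  "poissonized_sample lam \<equiv> measure_pmf (poisson_pmf lam) \<Otimes>\<^sub>M iid_sample"

lemma measurable_poissonized_sample [measurable]:
  "fst \<in> measurable (poissonized_sample lam) (count_space UNIV)"
  "(\<lambda>p. snd p i) \<in> borel_measurable (poissonized_sample lam)"
proof -
  show "fst \<in> measurable (poissonized_sample lam) (count_space UNIV)"
    by (rule measurable_compose[OF measurable_fst]) simp
  have "(\<lambda>p. snd p i) \<in> measurable (poissonized_sample lam) uniform_cube"
    by measurable
  then show "(\<lambda>p. snd p i) \<in> borel_measurable (poissonized_sample lam)"
    by simp
qed

text \<open>Given the size \<open>m\<close>, the void probability is the \<open>m\<close>-th power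
  of \<open>u\<close>; averaging over \<open>m\<close> evaluates the Poisson generating function at
  \<open>u\<close>.\<close>

lemma void_poissonized:
  fixes A :: "(real ^ 'd) set"
  assumes "0 < lam" and A [measurable]: "A \<in> sets borel"
  shows "measure (poissonized_sample lam) {p \<in> space (poissonized_sample lam). snd p ` {..<fst p} \<inter> A = {}} =
    exp (- (lam * measure uniform_cube A))"
proof -
  interpret S: prob_space "iid_sample :: (nat \<Rightarrow> real ^ 'd) measure" by (rule prob_space_iid_sample)
  interpret U: prob_space "uniform_cube :: (real ^ 'd) measure" by (rule prob_space_uniform_cube)
  let ?Q = "poissonized_sample lam :: (nat \<times> (nat \<Rightarrow> real ^ 'd)) measure"
  let ?E = "{p \<in> space ?Q. snd p ` {..<fst p} \<inter> A = {}}"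
  define u where "u = 1 - measure uniform_cube A"
  have u: "0 \<le> u" by (simp add: u_def)
  have "random_finite_set ?Q (\<lambda>p. snd p ` {..<fst p})"
    using random_finite_set_image_random[of "\<lambda>i p. snd p i" ?Q fst] by simp
  then have "?E \<in> sets ?Q" using A by (simp add: random_finite_set_def)
  then have "emeasure ?Q ?E = (\<integral>\<^sup>+m. emeasure iid_sample (Pair m -` ?E) \<partial>measure_pmf (poisson_pmf lam))"
    by (rule S.emeasure_pair_measure_alt)
  also have "\<dots> = (\<integral>\<^sup>+m. ennreal (u ^ m) \<partial>measure_pmf (poisson_pmf lam))"
  proof (intro nn_integral_cong)
    fix m
    have "Pair m -` ?E = {x \<in> space iid_sample. x ` {..<m} \<inter> A = {}}"
      by (auto simp: space_pair_measure)
    then show "emeasure iid_sample (Pair m -` ?E) = ennreal (u ^ m)"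
      using void_product[of m UNIV A] A by (simp add: S.emeasure_eq_measure u_def)
  qed
  also have "\<dots> = ennreal (exp (- (lam * (1 - u))))"
    using poisson_has_integral_power[OF assms(1) u] u
    by (subst nn_integral_eq_integral) (auto simp: has_bochner_integral_iff)
  finally show ?thesis
    by (simp add: measure_def u_def)
qed

text \<open>The colouring number is at most the number of points, whose Poisson mean is finite; this
  justifies Fubini's theorem.\<close>

lemma integral_poissonized:
  assumes "0 < lam"
  shows "integrable (poissonized_sample lam :: (nat \<times> (nat \<Rightarrow> real ^ 'd)) measure)
      (\<lambda>p. real (maxcol_dist k r (snd p ` {..<fst p})))"
    and "(\<integral>p. real (maxcol_dist k r (snd p ` {..<fst p}))
        \<partial>(poissonized_sample lam :: (nat \<times> (nat \<Rightarrow> real ^ 'd)) measure)) =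
      (\<integral>m. mean_maxcol TYPE('d) k r m \<partial>measure_pmf (poisson_pmf lam))"
proof -
  interpret S: prob_space "iid_sample :: (nat \<Rightarrow> real ^ 'd) measure" by (rule prob_space_iid_sample)
  interpret pair_sigma_finite "measure_pmf (poisson_pmf lam)" "iid_sample :: (nat \<Rightarrow> real ^ 'd) measure"
    by (intro pair_sigma_finite.intro measure_pmf.sigma_finite_measure_axioms S.sigma_finite_measure_axioms)
  let ?Q = "poissonized_sample lam :: (nat \<times> (nat \<Rightarrow> real ^ 'd)) measure"
  let ?f = "\<lambda>p. real (maxcol_dist k r (snd p ` {..<fst p}))"
  have meas: "?f \<in> borel_measurable ?Q"
    using random_finite_set_image_random[of "\<lambda>i p. snd p i" ?Q fst]
    by (intro measurable_compose[OF measurable_maxcol_dist]) auto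
  have "integrable (measure_pmf (poisson_pmf lam)) real"
    using poisson_has_integral_first[OF assms] by (simp add: has_bochner_integral_iff)
  then have "integrable (measure_pmf (poisson_pmf lam)) (\<lambda>m. mean_maxcol TYPE('d) k r m)"
    by (rule Bochner_Integration.integrable_bound) (auto simp: mean_maxcol_bounds)
  moreover have "integrable (iid_sample :: (nat \<Rightarrow> real ^ 'd) measure) (\<lambda>x. ?f (m, x))" for m
    by (intro S.integrable_const_bound[where B = "real m"] AE_I2
        measurable_compose[OF measurable_maxcol_dist[OF random_finite_set_product]])
      (auto simp: maxcol_image_le intro: measurable_compose[OF measurable_maxcol_dist[OF random_finite_set_product]])
  ultimately show int: "integrable ?Q ?f"
    using meas by (intro Fubini_integrable) (auto simp: mean_maxcol_def)
  show "(\<integral>p. ?f p \<partial>?Q) = (\<integral>m. mean_maxcol TYPE('d) k r m \<partial>measure_pmf (poisson_pmf lam))"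
    using integral_fst'[OF int] by (simp add: mean_maxcol_def)
qed

section \<open>The Poisson process in a box\<close>

context poisson_process
begin

lemma finite_Int_box: "\<omega> \<in> space P \<Longrightarrow> finite (X \<omega> \<inter> (cbox v w \<inter> A))"
  by (intro locally_finite bounded_Int) auto

lemma void_Int_box:
  assumes "A \<in> sets borel"
  shows "{\<omega> \<in> space P. X \<omega> \<inter> cbox v w \<inter> A = {}} \<in> sets P"
    and "prob {\<omega> \<in> space P. X \<omega> \<inter> cbox v w \<inter> A = {}} = exp (- (lam * measure lborel (cbox v w \<inter> A)))"
proof -
  have B: "cbox v w \<inter> A \<in> sets borel" "bounded (cbox v w \<inter> A)"
    using assms by (auto intro: bounded_Int)
  \<comment> \<open>Since \<open>card\<close> is 0 on infinite sets too, local finiteness is what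
    turns a zero count into an empty intersection.\<close>
  have eq: "{\<omega> \<in> space P. X \<omega> \<inter> cbox v w \<inter> A = {}} = {\<omega> \<in> space P. card (X \<omega> \<inter> (cbox v w \<inter> A)) = 0}"
    using finite_Int_box by (auto simp: Int_assoc)
  show "{\<omega> \<in> space P. X \<omega> \<inter> cbox v w \<inter> A = {}} \<in> sets P"
    unfolding eq using count_measurable[OF B] by measurable
  show "prob {\<omega> \<in> space P. X \<omega> \<inter> cbox v w \<inter> A = {}} = exp (- (lam * measure lborel (cbox v w \<inter> A)))"
    unfolding eq using count_poisson[OF B, of 0] by simp
qed

lemma random_finite_set_Int_box: "random_finite_set P (\<lambda>\<omega>. X \<omega> \<inter> cbox v w)"
  unfolding random_finite_set_def using void_Int_box(1) by (auto intro: locally_finite)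

text \<open>The process in the box and the affinely transported sample of Poisson size have the same
  void probabilities, hence colouring numbers of the same law. The resulting formula does not
  contain the corner \<open>v\<close>.\<close>

lemma
  fixes v :: "real ^ 'd"
  assumes "0 < t"
  shows integrable_maxcol_box: "integrable P (\<lambda>\<omega>. real (maxcol_dist k 1 (X \<omega> \<inter> cbox v (v + (\<chi> i. t)))))"
    and expectation_maxcol_box: "expectation (\<lambda>\<omega>. real (maxcol_dist k 1 (X \<omega> \<inter> cbox v (v + (\<chi> i. t))))) =
      (\<integral>m. mean_maxcol TYPE('d) k (1 / t) m \<partial>measure_pmf (poisson_pmf (lam * t ^ CARD('d))))"
proof -
  interpret S: prob_space "iid_sample :: (nat \<Rightarrow> real ^ 'd) measure" by (rule prob_space_iid_sample)
  define mu where "mu = lam * t ^ CARD('d)"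
  have mu: "0 < mu" using intensity_pos assms by (simp add: mu_def)
  let ?Q = "poissonized_sample mu :: (nat \<times> (nat \<Rightarrow> real ^ 'd)) measure"
  interpret Q: pair_prob_space "measure_pmf (poisson_pmf mu)" "iid_sample :: (nat \<Rightarrow> real ^ 'd) measure" ..
  let ?V = "\<lambda>p. (\<lambda>i. v + t *\<^sub>R snd p i) ` {..<fst p}"
  have V: "random_finite_set ?Q ?V"
    by (intro random_finite_set_image_random) measurable
  have W: "?V p = (\<lambda>x. v + t *\<^sub>R x) ` (snd p ` {..<fst p})" for p
    by (simp add: image_image)
  have void: "prob {\<omega> \<in> space P. X \<omega> \<inter> cbox v (v + (\<chi> i. t)) \<inter> A = {}} =
      measure ?Q {p \<in> space ?Q. ?V p \<inter> A = {}}" if A: "A \<in> sets borel" for A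
  proof -
    let ?A = "{x. v + t *\<^sub>R x \<in> A}"
    have "?A \<in> sets borel"
      using A measurable_sets_borel[of "\<lambda>x. v + t *\<^sub>R x" borel A] by (simp add: vimage_def)
    note * = void_poissonized[OF mu this]
    have "(\<lambda>x. v + t *\<^sub>R x) ` S \<inter> A = {} \<longleftrightarrow> S \<inter> ?A = {}" for S by blast
    then have "measure ?Q {p \<in> space ?Q. ?V p \<inter> A = {}} = exp (- (mu * measure uniform_cube ?A))"
      unfolding W by (simp only: *)
    then show ?thesis
      unfolding void_Int_box(2)[OF A] by (simp add: measure_uniform_cube_affine[OF assms A] mu_def)
  qed
  have "distr P (count_space UNIV) (\<lambda>\<omega>. maxcol_dist k 1 (X \<omega> \<inter> cbox v (v + (\<chi> i. t)))) =
      distr ?Q (count_space UNIV) (\<lambda>p. maxcol_dist k 1 (?V p))"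
    by (intro distr_maxcol_eq closed_dist_le random_finite_set_Int_box V void
        prob_space_axioms Q.prob_space_axioms)
  note * = integral_count_distr_cong[OF this measurable_maxcol_dist[OF random_finite_set_Int_box]
      measurable_maxcol_dist[OF V]]
  show "integrable P (\<lambda>\<omega>. real (maxcol_dist k 1 (X \<omega> \<inter> cbox v (v + (\<chi> i. t)))))"
    unfolding *(2) W maxcol_dist_affine[OF assms] by (rule integral_poissonized[OF mu])
  show "expectation (\<lambda>\<omega>. real (maxcol_dist k 1 (X \<omega> \<inter> cbox v (v + (\<chi> i. t))))) =
      (\<integral>m. mean_maxcol TYPE('d) k (1 / t) m \<partial>measure_pmf (poisson_pmf (lam * t ^ CARD('d))))"
    unfolding *(1) W maxcol_dist_affine[OF assms] mu_def[symmetric] by (rule integral_poissonized[OF mu])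
qed

end

section \<open>Subadditivity and the limit\<close>

lemma filterlim_root_at_top:
  assumes "0 < n"
  shows "filterlim (root n) at_top at_top"
proof (subst filterlim_at_top_gt[where c = 0], intro allI impI)
  fix Z :: real assume "0 < Z"
  show "\<forall>\<^sub>F y in at_top. Z \<le> root n y"
    using eventually_ge_at_top[of "Z ^ n"]
  proof eventually_elim
    case (elim y)
    then show ?case
      using assms \<open>0 < Z\<close> real_root_le_mono[of n "Z ^ n" y] by (simp add: real_root_power_cancel)
  qed
qed

text \<open>Closed tiles overlap on their faces, but a covering is all that subadditivity
  needs.\<close>

lemma cube_subset_tiles:
  assumes "0 < t" "0 < L" "L \<le> real c * t"
  shows "(cube L :: (real ^ 'd) set) \<subseteq> (\<Union>z\<in>PiE UNIV (\<lambda>_. {..<c}).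
    cbox (\<chi> i. real (z i) * t) ((\<chi> i. real (z i) * t) + (\<chi> i. t)))"
proof
  fix x :: "real ^ 'd" assume x: "x \<in> cube L"
  have "\<exists>m<c. real m * t \<le> x $ i \<and> x $ i \<le> real m * t + t" for i
  proof -
    have xi: "0 \<le> x $ i" "x $ i \<le> real c * t"
      using x assms by (auto simp: cube_def mem_box_cart intro: order_trans)
    show ?thesis
    \<comment> \<open>The floor of \<open>x $ i / t\<close> numbers the tile. On the far face it
      would be \<open>c\<close>, and the closed tile \<open>c - 1\<close> is taken instead.\<close>
    proof (cases "x $ i = real c * t")
      case True
      moreover have "0 < c" using assms by (intro gr0I) auto
      ultimately show ?thesis
        using assms by (intro exI[of _ "c - 1"]) (auto simp: of_nat_diff algebra_simps)
    next
      case False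
      define m where "m = nat \<lfloor>x $ i / t\<rfloor>"
      have m: "real m \<le> x $ i / t" "x $ i / t < real m + 1"
        using xi(1) assms(1) by (auto simp: m_def)
      have "x $ i / t < real c"
        using False xi(2) assms(1) by (simp add: pos_divide_less_eq)
      then have "m < c" using m(1) by linarith
      then show ?thesis using m assms(1) by (auto simp: field_simps)
    qed
  qed
  then obtain z where "\<And>i. z i < c \<and> real (z i) * t \<le> x $ i \<and> x $ i \<le> real (z i) * t + t"
    by metis
  then show "x \<in> (\<Union>z\<in>PiE UNIV (\<lambda>_. {..<c}).
      cbox (\<chi> i. real (z i) * t) ((\<chi> i. real (z i) * t) + (\<chi> i. t)))"
    by (intro UN_I[of z]) (auto simp: mem_box_cart)
qed

context poisson_process
begin

lemma F_count_eq: "F_count k X t \<omega> = maxcol_dist k 1 (X \<omega> \<inter> cbox 0 (0 + (\<chi> i. t)))"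
  by (simp add: F_count_def max_colorable_eq_maxcol cube_eq_box Int_commute)

lemma F_mean_nonneg: "0 < t \<Longrightarrow> 0 \<le> F_mean k P lam X t"
  using intensity_pos by (simp add: F_mean_def)

lemma a_const_le: "0 < t \<Longrightarrow> a_const k P lam X \<le> F_mean k P lam X t"
  unfolding a_const_def by (intro cINF_lower bdd_belowI[of _ 0]) (auto intro: F_mean_nonneg)

text \<open>Subadditivity over \<open>c ^ CARD('d)\<close> tiles bounds the colouring number in the
  large cube by a sum whose terms all have the same mean.\<close>

lemma expectation_F_count_tiles:
  assumes "0 < t" "0 < L" "L \<le> real c * t"
  shows "expectation (\<lambda>\<omega>. real (F_count k X L \<omega>)) \<le>
    real c ^ CARD('d) * expectation (\<lambda>\<omega>. real (F_count k X t \<omega>))"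
proof -
  let ?Z = "PiE UNIV (\<lambda>_ :: 'd. {..<c})"
  let ?B = "\<lambda>z :: 'd \<Rightarrow> nat. cbox (\<chi> i. real (z i) * t) ((\<chi> i. real (z i) * t) + (\<chi> i. t))"
  let ?f = "\<lambda>z \<omega>. real (maxcol_dist k 1 (X \<omega> \<inter> ?B z))"
  have Z: "finite ?Z" by (intro finite_PiE) auto
  have le: "real (F_count k X L \<omega>) \<le> (\<Sum>z\<in>?Z. ?f z \<omega>)" if "\<omega> \<in> space P" for \<omega>
  proof -
    have fin: "finite (X \<omega> \<inter> ?B z)" for z
      using that by (intro locally_finite) auto
    have "F_count k X L \<omega> \<le> maxcol_dist k 1 (\<Union>z\<in>?Z. X \<omega> \<inter> ?B z)"
      unfolding F_count_eq
    proof (intro maxcol_mono)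
      show "finite (\<Union>z\<in>?Z. X \<omega> \<inter> ?B z)" using Z fin by (rule finite_UN_I)
      show "X \<omega> \<inter> cbox 0 (0 + (\<chi> i. L)) \<subseteq> (\<Union>z\<in>?Z. X \<omega> \<inter> ?B z)"
        using cube_subset_tiles[OF assms] unfolding cube_eq_box by blast
    qed
    also have "\<dots> \<le> (\<Sum>z\<in>?Z. maxcol_dist k 1 (X \<omega> \<inter> ?B z))"
      by (intro maxcol_UN Z fin)
    finally have "real (F_count k X L \<omega>) \<le> real (\<Sum>z\<in>?Z. maxcol_dist k 1 (X \<omega> \<inter> ?B z))"
      by (rule of_nat_mono)
    then show ?thesis by simp
  qed
  have "expectation (\<lambda>\<omega>. real (F_count k X L \<omega>)) \<le> expectation (\<lambda>\<omega>. \<Sum>z\<in>?Z. ?f z \<omega>)"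
    using le by (intro integral_mono Bochner_Integration.integrable_sum
        integrable_maxcol_box[OF assms(1)]) (simp_all only: F_count_eq integrable_maxcol_box[OF assms(2)])
  also have "\<dots> = (\<Sum>z\<in>?Z. expectation (?f z))"
    by (intro Bochner_Integration.integral_sum integrable_maxcol_box[OF assms(1)])
  \<comment> \<open>Translation invariance: the formula for the mean in a box depends only on its
    side.\<close>
  also have "\<dots> = (\<Sum>z\<in>?Z. expectation (\<lambda>\<omega>. real (F_count k X t \<omega>)))"
    unfolding F_count_eq expectation_maxcol_box[OF assms(1)] ..
  also have "\<dots> = real c ^ CARD('d) * expectation (\<lambda>\<omega>. real (F_count k X t \<omega>))"
    by (simp add: card_PiE)
  finally show ?thesis .
qed

text \<open>The lower bound is immediate, \<open>a_const\<close> being an infimum. For the upper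
  bound, a side \<open>t\<close> with a mean below \<open>y\<close> is fixed and large cubes are
  tiled by cubes of side \<open>t\<close>; the loss from rounding the number of tiles up is a factor
  tending to 1.\<close>

lemma F_mean_tendsto:
  assumes "filterlim L at_top F"
  shows "((\<lambda>n. F_mean k P lam X (L n)) \<longlongrightarrow> a_const k P lam X) F"
proof (rule order_tendstoI)
  fix y assume y: "y < a_const k P lam X"
  have "\<forall>\<^sub>F n in F. 0 < L n"
    using assms by (simp add: filterlim_at_top_dense)
  then show "\<forall>\<^sub>F n in F. y < F_mean k P lam X (L n)"
    by eventually_elim (use y a_const_le in \<open>auto intro: less_le_trans\<close>)
next
  fix y assume "a_const k P lam X < y"
  then obtain t where t: "0 < t" "F_mean k P lam X t < y"
    unfolding a_const_def by (subst (asm) cINF_less_iff) (auto intro!: bdd_belowI[of _ 0] F_mean_nonneg)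
  have "((\<lambda>n. (t / L n + 1) ^ CARD('d) * F_mean k P lam X t) \<longlongrightarrow>
      (0 + 1) ^ CARD('d) * F_mean k P lam X t) F"
    by (intro tendsto_intros tendsto_divide_0[OF tendsto_const] filterlim_at_top_imp_at_infinity assms)
  then have "\<forall>\<^sub>F n in F. (t / L n + 1) ^ CARD('d) * F_mean k P lam X t < y"
    using t(2) by (intro order_tendstoD) auto
  moreover have "\<forall>\<^sub>F n in F. 0 < L n"
    using assms by (simp add: filterlim_at_top_dense)
  ultimately show "\<forall>\<^sub>F n in F. F_mean k P lam X (L n) < y"
  proof eventually_elim
    case (elim n)
    \<comment> \<open>Rounding up costs less than one tile per axis, whence the factor
      \<open>(t / L n + 1) ^ CARD('d)\<close>.\<close>
    define c where "c = nat \<lceil>L n / t\<rceil>"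
    have c: "L n / t \<le> real c" "real c \<le> L n / t + 1"
      using elim(2) t(1) by (auto simp: c_def)
    let ?E = "expectation (\<lambda>\<omega>. real (F_count k X t \<omega>))"
    have "F_mean k P lam X (L n) \<le> real c ^ CARD('d) * ?E / (lam * L n ^ CARD('d))"
      unfolding F_mean_def using c(1) t(1) elim(2) intensity_pos
      by (intro divide_right_mono expectation_F_count_tiles) (auto simp: field_simps)
    also have "\<dots> = (real c * t / L n) ^ CARD('d) * F_mean k P lam X t"
      using t(1) elim(2) intensity_pos by (simp add: F_mean_def power_mult_distrib power_divide)
    also have "\<dots> \<le> (t / L n + 1) ^ CARD('d) * F_mean k P lam X t"
      using c(2) t(1) elim(2) F_mean_nonneg[OF t(1)]
      by (intro mult_right_mono power_mono) (auto simp: field_simps)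
    finally show ?case using elim(1) by simp
  qed
qed

text \<open>The side \<open>L\<close> makes the expected number of Poisson points in the cube
  exactly \<open>n\<close>. Then \<open>F_mean\<close> averages \<open>mean_maxcol\<close> over a
  Poisson size of mean \<open>n\<close>, with the same normalization by \<open>n\<close>, and the
  Lipschitz bound reduces the difference to the mean deviation of that size.\<close>

lemma mean_maxcol_depoissonized:
  assumes "0 < n"
  defines "L \<equiv> root CARD('d) (real n / lam)"
  shows "\<bar>mean_maxcol TYPE('d) k (1 / L) n / real n - F_mean k P lam X L\<bar> \<le> 1 / sqrt (real n)"
proof -
  have L: "0 < L" "lam * L ^ CARD('d) = real n"
    using assms intensity_pos by (auto simp: L_def)
  let ?p = "measure_pmf (poisson_pmf (real n))"
  let ?h = "mean_maxcol TYPE('d) k (1 / L)"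
  have n: "0 < real n" using assms by simp
  have "integrable ?p real"
    using poisson_has_integral_first[OF n] by (simp add: has_bochner_integral_iff)
  then have int: "integrable ?p ?h"
    by (rule Bochner_Integration.integrable_bound) (auto simp: mean_maxcol_bounds)
  have F: "F_mean k P lam X L = (\<integral>m. ?h m \<partial>?p) / real n"
    unfolding F_mean_def F_count_eq expectation_maxcol_box[OF L(1)] L(2) ..
  have "\<bar>(\<integral>m. ?h m \<partial>?p) - ?h n\<bar> = \<bar>\<integral>m. ?h m - ?h n \<partial>?p\<bar>"
    using int by simp
  also have "\<dots> \<le> (\<integral>m. \<bar>?h m - ?h n\<bar> \<partial>?p)"
    by (rule integral_abs_bound)
  also have "\<dots> \<le> (\<integral>m. \<bar>real m - real n\<bar> \<partial>?p)"
    using int poisson_mean_deviation(1)[OF n] by (intro integral_mono mean_maxcol_lipschitz) auto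
  also have "\<dots> \<le> sqrt (real n)" by (rule poisson_mean_deviation(2)[OF n])
  finally have "\<bar>?h n - (\<integral>m. ?h m \<partial>?p)\<bar> \<le> sqrt (real n)" by (simp add: abs_minus_commute)
  then have "\<bar>?h n - (\<integral>m. ?h m \<partial>?p)\<bar> / real n \<le> sqrt (real n) / real n"
    by (intro divide_right_mono) auto
  then show ?thesis
    unfolding F using n by (simp add: sqrt_divide_self_eq inverse_eq_divide flip: diff_divide_distrib)
qed

lemma mean_maxcol_tendsto:
  "(\<lambda>n. mean_maxcol TYPE('d) k (root CARD('d) (lam / real n)) n / real n) \<longlonglongrightarrow> a_const k P lam X"
proof -
  define L where "L n = root CARD('d) (real n / lam)" for n :: nat
  \<comment> \<open>This identifies the rescaled radius with that of the theorem. At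
    \<open>n = 0\<close> both sides are 0, as division by zero yields 0.\<close>
  have r: "1 / L n = root CARD('d) (lam / real n)" for n
    by (simp add: L_def real_root_divide)
  have "filterlim L at_top sequentially"
    unfolding L_def using intensity_pos
    by (intro filterlim_compose[OF filterlim_root_at_top])
      (auto intro!: filterlim_tendsto_pos_mult_at_top[OF tendsto_const] filterlim_real_sequentially
        simp: divide_inverse mult.commute[of "real _"])
  then have F: "(\<lambda>n. F_mean k P lam X (L n)) \<longlonglongrightarrow> a_const k P lam X" by (rule F_mean_tendsto)
  have "(\<lambda>n. mean_maxcol TYPE('d) k (1 / L n) n / real n - F_mean k P lam X (L n)) \<longlonglongrightarrow> 0"
  proof (rule tendsto_rabs_zero_cancel, rule tendsto_sandwich[OF _ _ tendsto_const])
    show "\<forall>\<^sub>F n in sequentially. \<bar>mean_maxcol TYPE('d) k (1 / L n) n / real n - F_mean k P lam X (L n)\<bar>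
        \<le> 1 / sqrt (real n)"
      using eventually_gt_at_top[of 0] by eventually_elim (simp only: L_def mean_maxcol_depoissonized)
    show "(\<lambda>n. 1 / sqrt (real n)) \<longlonglongrightarrow> 0"
      by (intro tendsto_divide_0[OF tendsto_const] filterlim_at_top_imp_at_infinity
          filterlim_compose[OF sqrt_at_top filterlim_real_sequentially])
  qed simp
  from tendsto_add[OF this F] show ?thesis by (simp add: r)
qed

end

theorem proposition8:
  fixes k :: nat and \<nu> :: real
    and M :: "'w measure" and Y :: "nat \<Rightarrow> nat \<Rightarrow> 'w \<Rightarrow> real ^ 'd"
    and P :: "'p measure" and X :: "'p \<Rightarrow> (real ^ 'd) set"
  assumes "k \<ge> 1" and "\<nu> > 0"
    and "prob_space M"
    and "\<And>n. n \<ge> 1 \<Longrightarrow> iid_uniform_points M n (Y n)"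
    and "poisson_process P \<nu> X"
  shows "AE \<omega> in M. (\<lambda>n. H_ratio k (root CARD('d) (\<nu> / real n)) n (Y n) \<omega>) \<longlonglongrightarrow> a_const k P \<nu> X"
proof -
  interpret poisson_process P \<nu> X by fact
  let ?r = "\<lambda>n :: nat. root CARD('d) (\<nu> / real n)"
  have "AE \<omega> in M. (\<lambda>n. (real (maxcol_dist k (?r n) ((\<lambda>i. Y n i \<omega>) ` {..<n})) -
      mean_maxcol TYPE('d) k (?r n) n) / real n) \<longlonglongrightarrow> 0"
    using assms(3,4) by (intro AE_maxcol_deviation) auto
  then show ?thesis
  proof eventually_elim
    case (elim \<omega>)
    \<comment> \<open>The normalized deviation tends to 0 and the normalized mean to
      \<open>a_const\<close>; their sum is \<open>H_ratio\<close>.\<close>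
    from tendsto_add[OF elim mean_maxcol_tendsto[of k]] show ?case
      by (simp add: H_ratio_def max_colorable_eq_maxcol diff_divide_distrib)
  qed
qed

end
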